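(* Let $F$ be a field, $A$ a finite subset of $\mathbb N$, $Q,T\in\Pi_A^<$, and $k\in\mathbb N_0=\{0,1,2,\ldots\}$. Then $M_T$ occurs as a direct summand in the $k$th Loewy layer of $\Lambda_Q$ if and only if $Q\preceq T$ and $\ell(Q)-\ell(T)=k$.
   Context: For a finite subset $A$ of $\mathbb N=\{1,2,\ldots\}$, a set composition of $A$ is a tuple $P=(P_1,\ldots,P_l)$ of mutually disjoint non-empty subsets of $A$ with union $A$; its length is $\ell(P)=l$; $\Pi_A$ is the set of all set compositions of $A$ ($\Pi_\emptyset$ consists of the empty tuple). $F\Pi_A$ is the $F$-vector space with basis $\Pi_A$, an associative algebra with identity under the bilinear product $(P_1,\ldots,P_l)\wedge(Q_1,\ldots,Q_k)=(P_1\cap Q_1,\ldots,P_1\cap Q_k,\ldots,P_l\cap Q_1,\ldots,P_l\cap Q_k)$ with empty sets deleted. On $\bigoplus_AF\Pi_A$ (over all finite $A\subset\mathbb N$), $\vee$ is the bilinear product with $P\vee Q=(P_1,\ldots,P_l,Q_1,\ldots,Q_k)$ for $P\in\Pi_A$, $Q\in\Pi_B$, $A\cap B=\emptyset$, and $P\vee Q=0$ if $A\cap B\ne\emptyset$. For non-empty finite $B$: $e_B=\sum_P(-1)^{\ell(P)-1}P$, the sum over all $P=(P_1,\ldots,P_l)\in\Pi_B$ with $\min B\in P_1$. For $Q=(Q_1,\ldots,Q_k)\in\Pi_A$, $e_Q=e_{Q_1}\vee\cdots\vee e_{Q_k}$ (the empty tuple if $k=0$), $\Lambda_Q=F\Pi_A\wedge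 e_Q$, an indecomposable left ideal of $F\Pi_A$, and $M_Q=\Lambda_Q/\mathrm{rad}_{F\Pi_A}\Lambda_Q$, a one-dimensional irreducible module. $\Pi_A^<=\{(Q_1,\ldots,Q_k)\in\Pi_A\mid\min Q_1<\cdots<\min Q_k\}$. For $P,Q\in\Pi_A$, $Q\preceq P$ means that each component of $Q$ is contained in a component of $P$. For a finite-dimensional algebra $\mathcal A$ and a left $\mathcal A$-module $M$, $\mathrm{rad}_{\mathcal A}M$ is the intersection of all maximal submodules of $M$; $\mathrm{rad}^{(0)}_{\mathcal A}M=M$, $\mathrm{rad}^{(k+1)}_{\mathcal A}M=\mathrm{rad}_{\mathcal A}(\mathrm{rad}^{(k)}_{\mathcal A}M)$; the $k$th Loewy layer of $M$ is $\mathrm{rad}^{(k)}_{\mathcal A}M/\mathrm{rad}^{(k+1)}_{\mathcal A}M$. *)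

theory Defs
  imports
    "HOL-Algebra.Module"
    "HOL-Algebra.AbelCoset"
    "HOL-Library.Poly_Mapping"
    "HOL-Library.Disjoint_Sets"
begin

section \<open>Left modules, radicals and Loewy layers\<close>

text \<open>
  A left module over a ring \<open>R\<close>, not necessarily commutative, is given by a record of type
  \<open>('r, 'm) module\<close>. The locale \<open>module\<close> of HOL-Algebra is not used because it requires \<open>R\<close> to be
  commutative; its locale \<open>submodule\<close> makes no such requirement. The fields \<open>mult\<close> and \<open>one\<close>,
  which the record inherits from rings, play no role for modules.
\<close>

definition regular_module :: "'r ring \<Rightarrow> ('r, 'r) module" where
  "regular_module R =
     \<lparr>carrier = carrier R, mult = mult R, one = one R, zero = zero R, add = add R,
      smult = mult R\<rparr>"

definition quotient_module :: "('r, 'm) module \<Rightarrow> 'm set \<Rightarrow> ('r, 'm set) module" where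
  "quotient_module M N =
     \<lparr>carrier = a_rcosets\<^bsub>M\<^esub> N, mult = undefined, one = undefined, zero = N, add = set_add M,
      smult = (\<lambda>r X. \<Union>x\<in>X. N +>\<^bsub>M\<^esub> (r \<odot>\<^bsub>M\<^esub> x))\<rparr>"

definition module_iso :: "'r ring \<Rightarrow> ('r, 'm) module \<Rightarrow> ('r, 'n) module \<Rightarrow> ('m \<Rightarrow> 'n) set" where
  "module_iso R M N =
     {f \<in> iso (add_monoid M) (add_monoid N).
        \<forall>r\<in>carrier R. \<forall>x\<in>carrier M. f (r \<odot>\<^bsub>M\<^esub> x) = r \<odot>\<^bsub>N\<^esub> f x}"

definition occurs_as_direct_summand ::
    "'r ring \<Rightarrow> ('r, 'n) module \<Rightarrow> ('r, 'm) module \<Rightarrow> bool" where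
  "occurs_as_direct_summand R S M \<longleftrightarrow>
     (\<exists>U V. submodule U R M \<and> submodule V R M \<and>
        U <+>\<^bsub>M\<^esub> V = carrier M \<and> U \<inter> V = {\<zero>\<^bsub>M\<^esub>} \<and>
        module_iso R S (M\<lparr>carrier := U\<rparr>) \<noteq> {})"

definition maximal_submodule :: "'m set \<Rightarrow> 'r ring \<Rightarrow> ('r, 'm) module \<Rightarrow> bool" where
  "maximal_submodule N R M \<longleftrightarrow>
     submodule N R M \<and> N \<noteq> carrier M \<and>
     (\<forall>K. submodule K R M \<and> N \<subseteq> K \<longrightarrow> K = N \<or> K = carrier M)"

text \<open>
  The radical is again a module, with the operations of \<open>M\<close>. Intersecting with \<open>carrier M\<close> only
  matters if there are no maximal submodules (as for \<open>M = 0\<close>), in which case the radical is \<open>M\<close>.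
\<close>

definition rad :: "'r ring \<Rightarrow> ('r, 'm) module \<Rightarrow> ('r, 'm) module" where
  "rad R M = M\<lparr>carrier := carrier M \<inter> \<Inter>{N. maximal_submodule N R M}\<rparr>"

definition rad_power :: "'r ring \<Rightarrow> nat \<Rightarrow> ('r, 'm) module \<Rightarrow> ('r, 'm) module" where
  "rad_power R k = rad R ^^ k"

definition loewy_layer :: "'r ring \<Rightarrow> ('r, 'm) module \<Rightarrow> nat \<Rightarrow> ('r, 'm set) module" where
  "loewy_layer R M k = quotient_module (rad_power R k M) (carrier (rad_power R (Suc k) M))"


section \<open>Set compositions\<close>

definition set_compositions :: "nat set \<Rightarrow> nat set list set" where
  "set_compositions A = {P. distinct P \<and> partition_on A (set P)}"

definition increasing_set_compositions :: "nat set \<Rightarrow> nat set list set" where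
  "increasing_set_compositions A = {Q \<in> set_compositions A. sorted_wrt (<) (map Min Q)}"

definition refines :: "nat set list \<Rightarrow> nat set list \<Rightarrow> bool"  (infix \<open>\<preceq>\<close> 50) where
  "Q \<preceq> P \<longleftrightarrow> (\<forall>q\<in>set Q. \<exists>p\<in>set P. q \<subseteq> p)"

definition comp_wedge :: "nat set list \<Rightarrow> nat set list \<Rightarrow> nat set list" where
  "comp_wedge P Q = [p \<inter> q. p \<leftarrow> P, q \<leftarrow> Q, p \<inter> q \<noteq> {}]"


section \<open>The algebra of set compositions and its modules\<close>

text \<open>
  Formal linear combinations of set compositions are finitely supported functions on all lists of
  sets of natural numbers. Since every list lies in \<open>set_compositions A\<close> for at most one \<open>A\<close>, the
  functions supported on set compositions form the direct sum over all \<open>A\<close>.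
\<close>

type_synonym 'f comp_sum = "nat set list \<Rightarrow>\<^sub>0 'f"

definition wedge :: "'f::field comp_sum \<Rightarrow> 'f comp_sum \<Rightarrow> 'f comp_sum" where
  "wedge x y =
     (\<Sum>P\<in>Poly_Mapping.keys x. \<Sum>Q\<in>Poly_Mapping.keys y.
        Poly_Mapping.single (comp_wedge P Q)
          (Poly_Mapping.lookup x P * Poly_Mapping.lookup y Q))"

definition vee :: "'f::field comp_sum \<Rightarrow> 'f comp_sum \<Rightarrow> 'f comp_sum" where
  "vee x y =
     (\<Sum>P\<in>Poly_Mapping.keys x. \<Sum>Q\<in>Poly_Mapping.keys y.
        if \<Union>(set P) \<inter> \<Union>(set Q) = {}
        then Poly_Mapping.single (P @ Q) (Poly_Mapping.lookup x P * Poly_Mapping.lookup y Q)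
        else 0)"

definition comp_algebra :: "nat set \<Rightarrow> 'f::field comp_sum ring" where
  "comp_algebra A =
     \<lparr>carrier = {x. Poly_Mapping.keys x \<subseteq> set_compositions A},
      mult = wedge,
      one = Poly_Mapping.single (if A = {} then [] else [A]) 1,
      zero = 0,
      add = (+)\<rparr>"

definition e_block :: "nat set \<Rightarrow> 'f::field comp_sum" where
  "e_block B =
     (\<Sum>P\<in>{P \<in> set_compositions B. Min B \<in> hd P}.
        Poly_Mapping.single P ((-1) ^ (length P - 1)))"

definition e_comp :: "nat set list \<Rightarrow> 'f::field comp_sum" where
  "e_comp Q = foldr vee (map e_block Q) (Poly_Mapping.single [] 1)"

definition Lambda :: "nat set \<Rightarrow> nat set list \<Rightarrow> ('f::field comp_sum, 'f comp_sum) module" where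
  "Lambda A Q =
     (regular_module (comp_algebra A))
       \<lparr>carrier := (\<lambda>x. wedge x (e_comp Q)) ` carrier (comp_algebra A)\<rparr>"

definition simple_module ::
    "nat set \<Rightarrow> nat set list \<Rightarrow> ('f::field comp_sum, 'f comp_sum set) module" where
  "simple_module A Q =
     quotient_module (Lambda A Q) (carrier (rad (comp_algebra A) (Lambda A Q)))"

end

theory Submission
  imports Defs "HOL-Library.Multiset" HOL.Vector_Spaces
begin

text \<open>
  The set compositions of \<open>A\<close> form a left regular band, and \<open>\<Lambda>\<^sub>Q\<close> behaves like the multilinear part of
  the free associative algebra whose letters are the blocks of \<open>Q\<close>: it is spanned by the products
  \<open>e\<^sub>R\<close> over the rearrangements \<open>R\<close> of \<open>Q\<close>, and a set composition \<open>P\<close> sorts the factors of \<open>e\<^sub>R\<close>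
  according to the blocks of \<open>P\<close>, or gives \<open>0\<close> if it cuts a block of \<open>Q\<close>. As in the theorem of
  Poincare, Birkhoff and Witt, let \<open>D\<^sub>m\<close> (\<open>lie_span\<close>) be the span of all products of fewer than \<open>m\<close>
  iterated brackets in which every block of \<open>Q\<close> occurs once. With \<open>n = \<ell>(Q)\<close>, we have
  \<open>D\<^bsub>n+1\<^esub> = \<Lambda>\<^sub>Q\<close>, and the claim behind the theorem is that the radical series is this filtration:
  \<open>rad\<^sup>k \<Lambda>\<^sub>Q = D\<^bsub>n+1-k\<^esub>\<close>, over a field of any characteristic.

  The quotients are semisimple for two reasons. A set composition kills every bracket whose letters
  it does not put into one block (\<open>wedge_lie_cut\<close>; for a single letter this is the defining
  cancellation of \<open>e\<^sub>B\<close>, \<open>wedge_e_block_cut\<close>), so set compositions of length at least \<open>m\<close> kill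
  \<open>D\<^sub>m\<close>. And since \<open>xy - yx\<close> is a single bracket, the order of the factors only matters up to
  products with fewer factors (\<open>lie_prod_permute\<close>). It follows that an element of \<open>D\<^bsub>m+1\<^esub>\<close> lies in
  \<open>D\<^sub>m\<close> as soon as it is killed by all \<open>U\<close> of length \<open>m\<close> (\<open>lie_span_descend\<close>), and that
  \<open>U \<and> (P \<and> x)\<close> is \<open>U \<and> x\<close> or \<open>0\<close> according to whether \<open>U \<preceq> P\<close> (\<open>wedge_wedge_top\<close>). Thus the
  coefficients of the elements \<open>U \<and> x\<close> are functionals on \<open>D\<^bsub>m+1\<^esub>\<close> with common kernel \<open>D\<^sub>m\<close>, each
  of which is zero or has a maximal submodule as its kernel.

  Conversely, \<open>D\<^sub>m\<close> lies in every maximal submodule of \<open>D\<^bsub>m+1\<^esub>\<close> (\<open>lie_span_le_maximal\<close>). If a product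
  of \<open>i < n\<close> brackets is written as \<open>\<dots>xy\<dots> - \<dots>yx\<dots>\<close>, then it is \<open>(P - P') \<and> z\<close> where
  \<open>z = \<dots>xy\<dots>\<close> has one factor more and \<open>P\<close>, \<open>P'\<close> have the same blocks in different order
  (\<open>lie_prod_as_difference\<close>). Such a difference \<open>P - P'\<close> acts as \<open>0\<close> on every quotient
  \<open>D\<^bsub>i+1\<^esub>/D\<^sub>i\<close>, so an argument in the style of Nakayama's lemma applies.

  The module \<open>M\<^sub>T\<close> is one-dimensional, with \<open>P\<close> acting as \<open>1\<close> if \<open>T \<preceq> P\<close> and as \<open>0\<close> otherwise. If it
  occurs in \<open>D\<^bsub>m+1\<^esub>/D\<^sub>m\<close>, some \<open>U\<close> of length \<open>m\<close> does not kill the corresponding vector; comparing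
  the two characters gives \<open>U = T\<close>, and \<open>Q \<preceq> U\<close> since otherwise \<open>U\<close> kills \<open>\<Lambda>\<^sub>Q\<close> (\<open>occurs_only_if\<close>). If
  \<open>Q \<preceq> T\<close>, choose a bracketing of the blocks of \<open>Q\<close> inside each block of \<open>T\<close> and multiply these
  brackets to \<open>w\<close>. Right multiplication by \<open>w\<close> maps \<open>\<Lambda>\<^sub>T\<close> into \<open>D\<^bsub>m+1\<^esub>\<close> and induces an embedding of
  \<open>M\<^sub>T\<close>, whose image is complemented by the kernel of a coefficient functional (\<open>occurs_if\<close>).
\<close>

section \<open>Linear combinations of lists of sets\<close>

definition scl :: "'f::field \<Rightarrow> 'f comp_sum \<Rightarrow> 'f comp_sum" where
  "scl c x = Poly_Mapping.map ((*) c) x"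

lemma lookup_scl [simp]: "Poly_Mapping.lookup (scl c x) R = c * Poly_Mapping.lookup x R"
  by (simp add: scl_def Poly_Mapping.map.rep_eq when_def)

interpretation cs: vector_space "scl :: 'f::field \<Rightarrow> 'f comp_sum \<Rightarrow> 'f comp_sum"
  by unfold_locales (auto intro!: poly_mapping_eqI simp: lookup_add algebra_simps)

interpretation cs_pair: vector_space_pair
  "scl :: 'f::field \<Rightarrow> 'f comp_sum \<Rightarrow> 'f comp_sum" "scl :: 'f \<Rightarrow> 'f comp_sum \<Rightarrow> 'f comp_sum" ..

abbreviation lin :: "('f::field comp_sum \<Rightarrow> 'f comp_sum) \<Rightarrow> bool" where
  "lin \<equiv> Vector_Spaces.linear scl scl"

abbreviation basis :: "nat set list \<Rightarrow> 'f::field comp_sum" where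
  "basis R \<equiv> Poly_Mapping.single R 1"

lemma linI:
  assumes "\<And>x y. f (x + y) = f x + f y" and "\<And>c x. f (scl c x) = scl c (f x)"
  shows "lin f"
  using assms by (simp add: Vector_Spaces.linear_iff cs.vector_space_axioms)

lemma keys_scl: "Poly_Mapping.keys (scl c x) \<subseteq> Poly_Mapping.keys x"
  by (auto simp: in_keys_iff)

lemma keys_minus_subset:
  "Poly_Mapping.keys (x - y) \<subseteq> Poly_Mapping.keys x \<union> Poly_Mapping.keys (y :: 'f::field comp_sum)"
  by (auto simp: in_keys_iff lookup_minus)

lemma sum_basis: "x = (\<Sum>R\<in>Poly_Mapping.keys x. scl (Poly_Mapping.lookup x R) (basis R))"
proof (rule poly_mapping_eqI)
  fix S
  have "(\<Sum>R\<in>Poly_Mapping.keys x. Poly_Mapping.lookup x R * (1 when R = S))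
      = (\<Sum>R\<in>Poly_Mapping.keys x. if R = S then Poly_Mapping.lookup x R else 0)"
    by (rule sum.cong) (auto simp: when_def)
  also have "\<dots> = Poly_Mapping.lookup x S"
    by (simp add: sum.delta in_keys_iff)
  finally show "Poly_Mapping.lookup x S
      = Poly_Mapping.lookup (\<Sum>R\<in>Poly_Mapping.keys x. scl (Poly_Mapping.lookup x R) (basis R)) S"
    by (simp add: lookup_sum lookup_single)
qed

lemma lin_eq_on_keys:
  assumes "lin f" and "lin g" and "\<And>R. R \<in> Poly_Mapping.keys x \<Longrightarrow> f (basis R) = g (basis R)"
  shows "f x = g x"
proof -
  have "f x = (\<Sum>R\<in>Poly_Mapping.keys x. scl (Poly_Mapping.lookup x R) (f (basis R)))"
    by (subst sum_basis) (simp add: cs_pair.linear_sum[OF assms(1)] cs_pair.linear_scale[OF assms(1)])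
  also have "\<dots> = (\<Sum>R\<in>Poly_Mapping.keys x. scl (Poly_Mapping.lookup x R) (g (basis R)))"
    using assms(3) by simp
  also have "\<dots> = g x"
    by (subst (4) sum_basis) (simp add: cs_pair.linear_sum[OF assms(2)] cs_pair.linear_scale[OF assms(2)])
  finally show ?thesis .
qed

lemma lin_image_subspace:
  assumes f: "lin f" and S: "cs.subspace S" and b: "\<And>R. R \<in> Poly_Mapping.keys x \<Longrightarrow> f (basis R) \<in> S"
  shows "f x \<in> S"
proof -
  have "f x = (\<Sum>R\<in>Poly_Mapping.keys x. scl (Poly_Mapping.lookup x R) (f (basis R)))"
    by (subst sum_basis) (simp add: cs_pair.linear_sum[OF f] cs_pair.linear_scale[OF f])
  then show ?thesis
    using b by (auto intro!: cs.subspace_sum[OF S] cs.subspace_scale[OF S])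
qed

lemma lin_span_subset:
  assumes f: "lin f" and S: "cs.subspace S" and b: "\<And>y. y \<in> B \<Longrightarrow> f y \<in> S" and x: "x \<in> cs.span B"
  shows "f x \<in> S"
proof -
  have "cs.subspace {x. f x \<in> S}"
    by (intro cs.subspaceI)
       (auto simp: cs_pair.linear_0[OF f] cs_pair.linear_add[OF f] cs_pair.linear_scale[OF f]
          intro: cs.subspace_0[OF S] cs.subspace_add[OF S] cs.subspace_scale[OF S])
  then show ?thesis
    using cs.span_minimal[of B "{x. f x \<in> S}"] b x by blast
qed

text \<open>
  The products \<open>wedge\<close> and \<open>vee\<close> are both of this form, so linearity in each argument is proved once.
\<close>

definition bilinear_extension ::
    "(nat set list \<Rightarrow> nat set list \<Rightarrow> 'f::field comp_sum) \<Rightarrow> 'f comp_sum \<Rightarrow> 'f comp_sum \<Rightarrow> 'f comp_sum"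
  where
  "bilinear_extension g x y =
     (\<Sum>P\<in>Poly_Mapping.keys x. \<Sum>Q\<in>Poly_Mapping.keys y.
        scl (Poly_Mapping.lookup x P * Poly_Mapping.lookup y Q) (g P Q))"

lemma bilinear_extension_left:
  assumes "finite S" and "Poly_Mapping.keys x \<subseteq> S"
  shows "bilinear_extension g x y =
     (\<Sum>P\<in>S. \<Sum>Q\<in>Poly_Mapping.keys y.
        scl (Poly_Mapping.lookup x P * Poly_Mapping.lookup y Q) (g P Q))"
  unfolding bilinear_extension_def
  by (rule sum.mono_neutral_left) (use assms in \<open>auto simp: in_keys_iff\<close>)

lemma bilinear_extension_swap:
  "bilinear_extension g x y = bilinear_extension (\<lambda>P Q. g Q P) y x"
  unfolding bilinear_extension_def by (subst sum.swap) (simp add: mult.commute)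

lemma lin_bilinear_extension_left: "lin (\<lambda>x. bilinear_extension g x y)"
proof (rule linI)
  fix x x' :: "'a comp_sum"
  let ?S = "Poly_Mapping.keys x \<union> Poly_Mapping.keys x'"
  have "Poly_Mapping.keys (x + x') \<subseteq> ?S"
    by (rule keys_add)
  then show "bilinear_extension g (x + x') y = bilinear_extension g x y + bilinear_extension g x' y"
    by (simp add: bilinear_extension_left[of ?S] lookup_add cs.scale_left_distrib distrib_right
        sum.distrib)
next
  fix c and x :: "'a comp_sum"
  show "bilinear_extension g (scl c x) y = scl c (bilinear_extension g x y)"
    using keys_scl[of c x]
    by (simp add: bilinear_extension_left[of "Poly_Mapping.keys x"] cs.scale_sum_right mult.assoc)
qed

lemma lin_bilinear_extension_right: "lin (\<lambda>y. bilinear_extension g x y)"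
  by (subst bilinear_extension_swap) (rule lin_bilinear_extension_left)

lemma bilinear_extension_basis: "bilinear_extension g (basis P) (basis Q) = g P Q"
  by (simp add: bilinear_extension_def)

lemma scl_basis: "scl c (basis R) = Poly_Mapping.single R c"
  by (rule poly_mapping_eqI) (simp add: lookup_single when_def)

lemma wedge_bilinear_extension:
  "wedge = bilinear_extension (\<lambda>P Q. basis (comp_wedge P Q))"
  by (intro ext) (simp add: wedge_def bilinear_extension_def scl_basis)

lemma vee_bilinear_extension:
  "vee = bilinear_extension (\<lambda>P Q. if \<Union>(set P) \<inter> \<Union>(set Q) = {} then basis (P @ Q) else 0)"
  unfolding vee_def bilinear_extension_def
  by (intro ext sum.cong refl) (simp add: scl_basis)

lemma wedge_basis [simp]: "wedge (basis P) (basis Q) = basis (comp_wedge P Q)"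
  by (simp add: wedge_bilinear_extension bilinear_extension_basis)

lemma vee_basis:
  "vee (basis P) (basis Q) = (if \<Union>(set P) \<inter> \<Union>(set Q) = {} then basis (P @ Q) else 0)"
  by (simp add: vee_bilinear_extension bilinear_extension_basis)

lemmas lin_wedge_left =
  lin_bilinear_extension_left[of "\<lambda>P Q. basis (comp_wedge P Q)",
    folded wedge_bilinear_extension]
lemmas lin_wedge_right =
  lin_bilinear_extension_right[of "\<lambda>P Q. basis (comp_wedge P Q)",
    folded wedge_bilinear_extension]
lemmas lin_vee_left =
  lin_bilinear_extension_left[of "\<lambda>P Q. if \<Union>(set P) \<inter> \<Union>(set Q) = {} then basis (P @ Q) else 0",
    folded vee_bilinear_extension]
lemmas lin_vee_right =
  lin_bilinear_extension_right[of "\<lambda>P Q. if \<Union>(set P) \<inter> \<Union>(set Q) = {} then basis (P @ Q) else 0",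
    folded vee_bilinear_extension]

lemmas wedge_add_left = cs_pair.linear_add[OF lin_wedge_left]
lemmas wedge_add_right = cs_pair.linear_add[OF lin_wedge_right]
lemmas wedge_diff_left = cs_pair.linear_diff[OF lin_wedge_left]
lemmas wedge_diff_right = cs_pair.linear_diff[OF lin_wedge_right]
lemmas wedge_scl_left = cs_pair.linear_scale[OF lin_wedge_left]
lemmas wedge_scl_right = cs_pair.linear_scale[OF lin_wedge_right]
lemmas wedge_zero_left [simp] = cs_pair.linear_0[OF lin_wedge_left]
lemmas wedge_zero_right [simp] = cs_pair.linear_0[OF lin_wedge_right]
lemmas wedge_sum_right = cs_pair.linear_sum[OF lin_wedge_right]
lemmas vee_diff_left = cs_pair.linear_diff[OF lin_vee_left]
lemmas vee_diff_right = cs_pair.linear_diff[OF lin_vee_right]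
lemmas vee_zero_left [simp] = cs_pair.linear_0[OF lin_vee_left]
lemmas vee_zero_right [simp] = cs_pair.linear_0[OF lin_vee_right]

lemma lin_comp: "lin f \<Longrightarrow> lin g \<Longrightarrow> lin (\<lambda>x. f (g x))"
  by (rule linI) (simp_all add: cs_pair.linear_add cs_pair.linear_scale)

lemma vee_assoc: "vee (vee x y) z = vee x (vee y z)"
proof (rule lin_eq_on_keys[where x = x and f = "\<lambda>x. vee (vee x y) z"])
  fix P
  show "vee (vee (basis P) y) z = vee (basis P) (vee y z)"
  proof (rule lin_eq_on_keys[where x = y and f = "\<lambda>y. vee (vee (basis P) y) z"])
    fix Q
    show "vee (vee (basis P) (basis Q)) z = vee (basis P) (vee (basis Q) z)"
    proof (rule lin_eq_on_keys[where x = z])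
      fix R
      show "vee (vee (basis P) (basis Q)) (basis R) = vee (basis P) (vee (basis Q) (basis R :: 'a comp_sum))"
        by (auto simp: vee_basis Int_Un_distrib Int_Un_distrib2)
    qed (intro lin_vee_left lin_vee_right lin_comp[OF lin_vee_right])+
  qed (intro lin_vee_left lin_vee_right lin_comp[OF lin_vee_right] lin_comp[OF lin_vee_left])+
qed (intro lin_vee_left lin_vee_right lin_comp[OF lin_vee_right] lin_comp[OF lin_vee_left])+

lemma vee_empty_left [simp]: "vee (basis []) x = x"
  by (rule lin_eq_on_keys[where x = x]) (simp_all add: lin_vee_right cs.linear_ident vee_basis)

lemma vee_empty_right [simp]: "vee x (basis []) = x"
  by (rule lin_eq_on_keys[where x = x]) (simp_all add: lin_vee_left cs.linear_ident vee_basis)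

lemma keys_vee:
  "Poly_Mapping.keys (vee x y)
     \<subseteq> {P @ Q | P Q. P \<in> Poly_Mapping.keys x \<and> Q \<in> Poly_Mapping.keys y \<and> \<Union>(set P) \<inter> \<Union>(set Q) = {}}"
proof
  fix R assume "R \<in> Poly_Mapping.keys (vee x y)"
  then have "Poly_Mapping.lookup (vee x y) R \<noteq> 0"
    by (simp add: in_keys_iff)
  then obtain P where P: "P \<in> Poly_Mapping.keys x" and
    "Poly_Mapping.lookup (\<Sum>Q\<in>Poly_Mapping.keys y. if \<Union>(set P) \<inter> \<Union>(set Q) = {}
        then Poly_Mapping.single (P @ Q) (Poly_Mapping.lookup x P * Poly_Mapping.lookup y Q)
        else 0) R \<noteq> 0"
    unfolding vee_def by (subst (asm) lookup_sum) (rule sum.not_neutral_contains_not_neutral)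
  then obtain Q where Q: "Q \<in> Poly_Mapping.keys y" and
    "Poly_Mapping.lookup (if \<Union>(set P) \<inter> \<Union>(set Q) = {}
        then Poly_Mapping.single (P @ Q) (Poly_Mapping.lookup x P * Poly_Mapping.lookup y Q)
        else 0) R \<noteq> 0"
    by (subst (asm) lookup_sum) (rule sum.not_neutral_contains_not_neutral)
  then have "\<Union>(set P) \<inter> \<Union>(set Q) = {}" "R = P @ Q"
    by (auto simp: lookup_single when_def split: if_splits)
  with P Q show "R \<in> {P @ Q | P Q. P \<in> Poly_Mapping.keys x \<and> Q \<in> Poly_Mapping.keys y
      \<and> \<Union>(set P) \<inter> \<Union>(set Q) = {}}" by blast
qed

section \<open>The left regular band of set compositions\<close>

text \<open>
  The set composition that \<open>Q\<close> induces on \<open>p\<close>. The product of set compositions concatenates the traces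
  of the second factor on the blocks of the first, and most of its properties are properties of traces.
\<close>

definition trace :: "nat set \<Rightarrow> nat set list \<Rightarrow> nat set list" where
  "trace p Q = filter (\<lambda>q. q \<noteq> {}) (map ((\<inter>) p) Q)"

lemma trace_Nil [simp]: "trace p [] = []"
  and trace_Cons: "trace p (q # Q) = (if p \<inter> q = {} then trace p Q else (p \<inter> q) # trace p Q)"
  and trace_append [simp]: "trace p (Q @ R) = trace p Q @ trace p R"
  by (simp_all add: trace_def)

lemma trace_eq_Nil_iff: "trace p Q = [] \<longleftrightarrow> p \<inter> \<Union>(set Q) = {}"
  by (auto simp: trace_def filter_empty_conv)

lemma trace_trace: "trace p (trace q R) = trace (p \<inter> q) R"
  by (induction R) (auto simp: trace_Cons Int_assoc)

lemma trace_ident: "(\<And>r. r \<in> set R \<Longrightarrow> r \<subseteq> p \<and> r \<noteq> {}) \<Longrightarrow> trace p R = R"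
  by (induction R) (auto simp: trace_Cons Int_absorb1)

lemma Union_trace: "\<Union>(set (trace p Q)) = p \<inter> \<Union>(set Q)"
  by (auto simp: trace_def)

lemma comp_wedge_concat: "comp_wedge P Q = concat (map (\<lambda>p. trace p Q) P)"
proof -
  have "concat (map (\<lambda>q. if p \<inter> q \<noteq> {} then [p \<inter> q] else []) Q) = trace p Q" for p
    by (induction Q) (auto simp: trace_Cons)
  then show ?thesis
    by (simp add: comp_wedge_def)
qed

lemma comp_wedge_Nil [simp]: "comp_wedge [] Q = []"
  and comp_wedge_Cons: "comp_wedge (p # P) Q = trace p Q @ comp_wedge P Q"
  by (simp_all add: comp_wedge_concat)

lemma comp_wedge_append_left: "comp_wedge (P @ P') Q = comp_wedge P Q @ comp_wedge P' Q"
  by (simp add: comp_wedge_concat)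

lemma trace_comp_wedge: "trace p (comp_wedge Q R) = comp_wedge (trace p Q) R"
proof (induction Q)
  case (Cons q Q)
  have "p \<inter> q = {} \<Longrightarrow> trace (p \<inter> q) R = []"
    by (simp add: trace_eq_Nil_iff)
  with Cons show ?case
    by (auto simp: comp_wedge_Cons trace_Cons trace_trace)
qed simp

lemma comp_wedge_assoc: "comp_wedge (comp_wedge P Q) R = comp_wedge P (comp_wedge Q R)"
  by (induction P) (simp_all add: comp_wedge_Cons comp_wedge_append_left trace_comp_wedge)

lemma wedge_assoc: "wedge (wedge x y) z = wedge x (wedge y z)"
proof (rule lin_eq_on_keys[where x = x and f = "\<lambda>x. wedge (wedge x y) z"])
  fix P
  show "wedge (wedge (basis P) y) z = wedge (basis P) (wedge y z)"
  proof (rule lin_eq_on_keys[where x = y and f = "\<lambda>y. wedge (wedge (basis P) y) z"])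
    fix Q
    show "wedge (wedge (basis P) (basis Q)) z = wedge (basis P) (wedge (basis Q) z)"
    proof (rule lin_eq_on_keys[where x = z])
      fix R
      show "wedge (wedge (basis P) (basis Q)) (basis R) = wedge (basis P) (wedge (basis Q) (basis R :: 'a comp_sum))"
        by (simp add: comp_wedge_assoc)
    qed (intro lin_wedge_left lin_wedge_right lin_comp[OF lin_wedge_right])+
  qed (intro lin_wedge_left lin_wedge_right lin_comp[OF lin_wedge_right] lin_comp[OF lin_wedge_left])+
qed (intro lin_wedge_left lin_wedge_right lin_comp[OF lin_wedge_right] lin_comp[OF lin_wedge_left])+

lemma set_compositionsD:
  assumes "P \<in> set_compositions A"
  shows "distinct P" and "\<Union>(set P) = A" and "p \<in> set P \<Longrightarrow> p \<noteq> {}"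
    and "p \<in> set P \<Longrightarrow> q \<in> set P \<Longrightarrow> p \<noteq> q \<Longrightarrow> p \<inter> q = {}"
  using assms by (auto simp: set_compositions_def partition_on_def disjoint_def)

lemma Nil_in_set_compositions [simp]: "[] \<in> set_compositions A \<longleftrightarrow> A = {}"
  by (auto simp: set_compositions_def partition_on_def)

lemma Cons_in_set_compositions:
  "p # P \<in> set_compositions A \<longleftrightarrow> p \<noteq> {} \<and> p \<subseteq> A \<and> P \<in> set_compositions (A - p)"
proof
  assume "p # P \<in> set_compositions A"
  note * = set_compositionsD[OF this]
  have "\<Union>(set P) = A - p"
    using *(1,2) *(4)[of p] by (auto 4 3)
  then show "p \<noteq> {} \<and> p \<subseteq> A \<and> P \<in> set_compositions (A - p)"
    using *(1,2) *(3,4) by (auto simp: set_compositions_def partition_on_def disjoint_def)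
next
  assume *: "p \<noteq> {} \<and> p \<subseteq> A \<and> P \<in> set_compositions (A - p)"
  then have "P \<in> set_compositions (A - p)" by simp
  note ** = set_compositionsD[OF this]
  have "p \<notin> set P"
    using * **(2) by blast
  then show "p # P \<in> set_compositions A"
    using * **(1,2) by (auto simp: set_compositions_def partition_on_def disjoint_def)
qed

lemma finite_set_compositions: "finite A \<Longrightarrow> finite (set_compositions A)"
  by (rule finite_subset[OF _ finite_subset_distinct[of "Pow A"]])
     (auto simp: set_compositions_def partition_on_def)

lemma append_in_set_compositions:
  assumes "P \<in> set_compositions U" and "Q \<in> set_compositions V" and "U \<inter> V = {}"
  shows "P @ Q \<in> set_compositions (U \<union> V)"
  using assms
proof (induction P arbitrary: U)
  case (Cons p P)
  then have "P @ Q \<in> set_compositions ((U - p) \<union> V)" and "p \<subseteq> U"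
    by (auto simp: Cons_in_set_compositions)
  moreover have "(U - p) \<union> V = U \<union> V - p"
    using Cons.prems(3) \<open>p \<subseteq> U\<close> by blast
  ultimately show ?case
    using Cons.prems by (auto simp: Cons_in_set_compositions)
qed simp

lemma trace_in_set_compositions:
  "Q \<in> set_compositions B \<Longrightarrow> trace p Q \<in> set_compositions (p \<inter> B)"
proof (induction Q arbitrary: B)
  case (Cons q Q)
  then have q: "q \<noteq> {}" "q \<subseteq> B" and IH: "trace p Q \<in> set_compositions (p \<inter> (B - q))"
    by (auto simp: Cons_in_set_compositions)
  have "p \<inter> (B - q) = p \<inter> B - p \<inter> q" "p \<inter> q = {} \<Longrightarrow> p \<inter> (B - q) = p \<inter> B"
    by blast+
  with q IH show ?case
    by (auto simp: trace_Cons Cons_in_set_compositions)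
qed simp

lemma comp_wedge_in_set_compositions:
  "P \<in> set_compositions A \<Longrightarrow> Q \<in> set_compositions B \<Longrightarrow> comp_wedge P Q \<in> set_compositions (A \<inter> B)"
proof (induction P arbitrary: A)
  case (Cons p P)
  then have p: "p \<noteq> {}" "p \<subseteq> A" and IH: "comp_wedge P Q \<in> set_compositions ((A - p) \<inter> B)"
    by (auto simp: Cons_in_set_compositions)
  have "trace p Q @ comp_wedge P Q \<in> set_compositions ((p \<inter> B) \<union> ((A - p) \<inter> B))"
    by (rule append_in_set_compositions[OF trace_in_set_compositions[OF Cons.prems(2)] IH]) blast
  moreover have "(p \<inter> B) \<union> ((A - p) \<inter> B) = A \<inter> B"
    using p by blast
  ultimately show ?case
    by (simp add: comp_wedge_Cons)
qed simp

lemma trace_block: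
  assumes "Q \<in> set_compositions A" and "q \<in> set Q" and "p \<subseteq> q" and "p \<noteq> {}"
  shows "trace p Q = [p]"
  using assms
proof (induction Q arbitrary: A)
  case (Cons r Q)
  note * = set_compositionsD[OF Cons.prems(1)]
  from Cons.prems have Q: "Q \<in> set_compositions (A - r)"
    by (auto simp: Cons_in_set_compositions)
  show ?case
  proof (cases "q = r")
    case True
    then have "trace p Q = []"
      using set_compositionsD(2)[OF Q] Cons.prems by (auto simp: trace_eq_Nil_iff)
    with True Cons.prems show ?thesis
      by (auto simp: trace_Cons Int_absorb2)
  next
    case False
    with Cons.prems have "q \<in> set Q" "p \<inter> r = {}"
      using *(4)[of q r] by auto
    with Cons.IH[OF Q _ Cons.prems(3,4)] show ?thesis
      by (simp add: trace_Cons)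
  qed
qed simp

lemma comp_wedge_absorb:
  assumes Q: "Q \<in> set_compositions A" and P: "{} \<notin> set P" and le: "P \<preceq> Q"
  shows "comp_wedge P Q = P"
proof -
  have "concat (map (\<lambda>p. trace p Q) P) = concat (map (\<lambda>p. [p]) P)"
    using le P by (intro arg_cong[where f = concat] map_cong refl)
      (use trace_block[OF Q] in \<open>metis refines_def\<close>)
  then show ?thesis
    by (simp add: comp_wedge_concat)
qed

text \<open>
  Every block of \<open>P\<close> contributes its trace, which is never empty and has only one block precisely if the
  block of \<open>P\<close> lies inside a block of \<open>Q\<close>.
\<close>

lemma length_comp_wedge:
  assumes P: "P \<in> set_compositions A" and Q: "Q \<in> set_compositions A"
  shows "length P \<le> length (comp_wedge P Q)"
    and "\<not> P \<preceq> Q \<Longrightarrow> length P < length (comp_wedge P Q)"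
proof -
  note * = set_compositionsD[OF P] set_compositionsD[OF Q]
  have ne: "1 \<le> length (trace p Q)" if "p \<in> set P" for p
  proof -
    have "p \<inter> \<Union>(set Q) \<noteq> {}"
      using *(3)[OF that] *(2) *(6) that by blast
    then show ?thesis
      by (metis trace_eq_Nil_iff length_0_conv less_one linorder_not_le)
  qed
  have len: "length (comp_wedge P Q) = (\<Sum>p\<in>set P. length (trace p Q))"
    using *(1) by (simp add: comp_wedge_concat length_concat comp_def sum_list_distinct_conv_sum_set)
  have card: "length P = (\<Sum>p\<in>set P. 1)"
    using *(1) by (simp add: distinct_card)
  show "length P \<le> length (comp_wedge P Q)"
    unfolding len card by (rule sum_mono) (use ne in auto)
  assume "\<not> P \<preceq> Q"
  then obtain p where p: "p \<in> set P" "\<forall>q\<in>set Q. \<not> p \<subseteq> q"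
    by (auto simp: refines_def)
  have "length (trace p Q) \<noteq> 1"
  proof
    assume "length (trace p Q) = 1"
    then obtain r where r: "trace p Q = [r]"
      by (auto simp: length_Suc_conv)
    then have "r = p \<inter> \<Union>(set Q)"
      using Union_trace[of p Q] by simp
    then have "r = p"
      using * p(1) by auto
    moreover have "r \<in> set (trace p Q)"
      by (simp add: r)
    ultimately show False
      using p(2) by (auto simp: trace_def)
  qed
  with ne[OF p(1)] have "1 < length (trace p Q)"
    by simp
  then show "length P < length (comp_wedge P Q)"
    unfolding len card by (intro sum_strict_mono_ex1) (use ne p in auto)
qed

text \<open>
  Acting by \<open>P\<close> inside a word first makes no difference, because \<open>P\<close> does not change the trace on any of
  its own blocks. This is the left regular band identity that lets a zero of the action spread to
  products.
\<close>

lemma comp_wedge_inner: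
  assumes P: "P \<in> set_compositions A"
  shows "comp_wedge P (X @ comp_wedge P S @ Z) = comp_wedge P (X @ S @ Z)"
proof -
  have "trace p (comp_wedge P S) = trace p S" if "p \<in> set P" for p
    using trace_block[OF P that] set_compositionsD(3)[OF P that]
    by (simp add: trace_comp_wedge comp_wedge_Cons)
  then show ?thesis
    unfolding comp_wedge_concat[of P "X @ _"] by (intro arg_cong[where f = concat] map_cong) auto
qed

lemma Union_comp_wedge: "\<Union>(set (comp_wedge P Q)) = \<Union>(set P) \<inter> \<Union>(set Q)"
  by (induction P) (auto simp: comp_wedge_Cons Union_trace)

lemma refines_antisym:
  assumes P: "P \<in> set_compositions A" and Q: "Q \<in> set_compositions A" and "P \<preceq> Q" and "Q \<preceq> P"
  shows "set P = set Q"
proof -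
  have sub: "set P \<subseteq> set Q" if P: "P \<in> set_compositions A" "P \<preceq> Q" "Q \<preceq> P" for P Q
  proof
    fix p assume p: "p \<in> set P"
    then obtain q where q: "q \<in> set Q" "p \<subseteq> q"
      using \<open>P \<preceq> Q\<close> unfolding refines_def by blast
    then obtain p' where p': "p' \<in> set P" "q \<subseteq> p'"
      using \<open>Q \<preceq> P\<close> unfolding refines_def by blast
    have "p = p'"
      using set_compositionsD(3,4)[OF P(1)] p p' q by blast
    then show "p \<in> set Q"
      using q p' by auto
  qed
  from sub[OF P assms(3,4)] sub[OF Q assms(4,3)] show ?thesis by blast
qed

lemma refines_trans: "P \<preceq> Q \<Longrightarrow> Q \<preceq> R \<Longrightarrow> P \<preceq> R"
  unfolding refines_def by (meson subset_trans)

lemma refines_length: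
  assumes P: "P \<in> set_compositions A" and Q: "Q \<in> set_compositions A" and "P \<preceq> Q"
  shows "length Q \<le> length P" and "length P = length Q \<Longrightarrow> set P = set Q"
proof -
  note * = set_compositionsD[OF P] set_compositionsD[OF Q]
  obtain f where f: "\<And>p. p \<in> set P \<Longrightarrow> f p \<in> set Q \<and> p \<subseteq> f p"
    using \<open>P \<preceq> Q\<close> unfolding refines_def by metis
  have im: "f ` set P = set Q"
  proof
    show "f ` set P \<subseteq> set Q" using f by auto
    show "set Q \<subseteq> f ` set P"
    proof
      fix q assume q: "q \<in> set Q"
      then obtain x where x: "x \<in> q" using * by fastforce
      then obtain p where p: "p \<in> set P" "x \<in> p" using * q by (metis Union_iff)
      then have "q = f p"
        using f[OF p(1)] *(8)[OF q, of "f p"] x by blast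
      then show "q \<in> f ` set P" using p by blast
    qed
  qed
  have lens: "length P = card (set P)" "length Q = card (set Q)"
    using * by (simp_all add: distinct_card)
  show "length Q \<le> length P"
    unfolding lens im[symmetric] by (rule card_image_le) simp
  assume "length P = length Q"
  then have inj: "inj_on f (set P)"
    by (intro eq_card_imp_inj_on) (simp_all add: im lens)
  have "f p = p" if p: "p \<in> set P" for p
  proof
    show "p \<subseteq> f p" using f[OF p] by simp
    show "f p \<subseteq> p"
    proof
      fix x assume x: "x \<in> f p"
      then have "x \<in> A" using * f[OF p] by auto
      then obtain p' where p': "p' \<in> set P" "x \<in> p'" using * by auto
      then have "f p' = f p"
        using f[OF p] f[OF p'(1)] *(8)[of "f p'" "f p"] x by blast
      then show "x \<in> p"
        using inj p p' by (auto dest: inj_onD)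
    qed
  qed
  then show "set P = set Q"
    using im by auto
qed

section \<open>The idempotent of a single block\<close>

text \<open>
  For a set \<open>Y\<close> that does not contain the minimum, the set compositions in the sum \<open>e\<^sub>B\<close> come in pairs:
  the first block \<open>r\<close> that meets \<open>Y\<close> is either contained in \<open>Y\<close>, or it can be split into \<open>r - Y\<close>
  followed by \<open>r \<inter> Y\<close>. The inverse of splitting merges the first block meeting \<open>Y\<close> with its
  predecessor.
\<close>

fun split_at :: "nat set \<Rightarrow> nat set list \<Rightarrow> nat set list" where
  "split_at Y [] = []"
| "split_at Y (r # R) = (if r \<inter> Y = {} then r # split_at Y R else (r - Y) # (r \<inter> Y) # R)"

fun merge_at :: "nat set \<Rightarrow> nat set list \<Rightarrow> nat set list" where
  "merge_at Y (l # r # R) = (if r \<inter> Y = {} then l # merge_at Y (r # R) else (l \<union> r) # R)"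
| "merge_at Y R = R"

fun first_pure :: "nat set \<Rightarrow> nat set list \<Rightarrow> bool" where
  "first_pure Y [] = True"
| "first_pure Y (r # R) = (if r \<inter> Y = {} then first_pure Y R else r \<subseteq> Y)"

lemma split_at_mixed:
  assumes "R \<in> set_compositions B" and "\<not> first_pure Y R"
  shows "split_at Y R \<in> set_compositions B \<and> first_pure Y (split_at Y R)
    \<and> length (split_at Y R) = Suc (length R) \<and> merge_at Y (split_at Y R) = R
    \<and> hd (split_at Y R) = hd R - Y"
  using assms
proof (induction R arbitrary: B)
  case (Cons r R)
  show ?case
  proof (cases "r \<inter> Y = {}")
    case True
    with Cons.prems have R: "R \<in> set_compositions (B - r)" "\<not> first_pure Y R" "r \<noteq> {}" "r \<subseteq> B"
      by (auto simp: Cons_in_set_compositions)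
    note IH = Cons.IH[OF R(1,2)]
    then obtain s S where sS: "split_at Y R = s # S"
      by (cases "split_at Y R") auto
    then have "s \<inter> Y = {}"
      using IH by auto
    then show ?thesis
      using IH True R sS by (auto simp: Cons_in_set_compositions)
  next
    case False
    with Cons.prems have R: "R \<in> set_compositions (B - r)" "\<not> r \<subseteq> Y" "r \<noteq> {}" "r \<subseteq> B"
      by (auto simp: Cons_in_set_compositions)
    have "B - (r - Y) - r \<inter> Y = B - r" by blast
    then show ?thesis
      using R False by (auto simp: Cons_in_set_compositions)
  qed
qed simp

lemma merge_at_pure:
  assumes "R \<in> set_compositions B" and "first_pure Y R" and "Y \<inter> B \<noteq> {}" and "hd R \<inter> Y = {}"
  shows "merge_at Y R \<in> set_compositions B \<and> \<not> first_pure Y (merge_at Y R)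
    \<and> split_at Y (merge_at Y R) = R \<and> hd R \<subseteq> hd (merge_at Y R)"
  using assms
proof (induction Y R arbitrary: B rule: merge_at.induct)
  case (1 Y l r R)
  from 1(2) have lr: "l \<noteq> {}" "l \<subseteq> B" "r # R \<in> set_compositions (B - l)"
    by (auto simp: Cons_in_set_compositions)
  then have r: "r \<noteq> {}" "r \<subseteq> B - l" "R \<in> set_compositions (B - l - r)"
    by (auto simp: Cons_in_set_compositions)
  show ?case
  proof (cases "r \<inter> Y = {}")
    case True
    have "first_pure Y (r # R)" using 1 by auto
    moreover have "Y \<inter> (B - l) \<noteq> {}" using 1 by auto
    ultimately have "merge_at Y (r # R) \<in> set_compositions (B - l) \<and> \<not> first_pure Y (merge_at Y (r # R))
      \<and> split_at Y (merge_at Y (r # R)) = r # R \<and> hd (r # R) \<subseteq> hd (merge_at Y (r # R))"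
      using 1(1)[OF True lr(3)] True by auto
    then show ?thesis
      using True lr 1 by (auto simp: Cons_in_set_compositions)
  next
    case False
    then have "r \<subseteq> Y" using 1 by auto
    moreover have "l \<inter> Y = {}" using 1 by auto
    moreover have "B - (l \<union> r) = B - l - r" by blast
    moreover have "l \<union> r - Y = l" "(l \<union> r) \<inter> Y = r"
      using calculation by blast+
    ultimately show ?thesis
      using False lr r by (auto simp: Cons_in_set_compositions)
  qed
qed (auto simp: Cons_in_set_compositions)

lemma trace_split_at:
  assumes "\<Union>(set R) \<subseteq> B" and "q \<inter> B = Y \<or> q \<inter> Y = {}"
  shows "trace q (split_at Y R) = trace q R"
  using assms(1)
proof (induction R)
  case (Cons r R)
  show ?case
  proof (cases "r \<inter> Y = {}")
    case False
    from assms(2) have "(q \<inter> (r - Y) = {} \<and> q \<inter> (r \<inter> Y) = q \<inter> r) \<or> (q \<inter> (r \<inter> Y) = {} \<and> q \<inter> (r - Y) = q \<inter> r)"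
      using Cons.prems by auto
    then show ?thesis
      using False by (auto simp: trace_Cons)
  qed (use Cons in \<open>auto simp: trace_Cons\<close>)
qed simp

lemma keys_e_block: "Poly_Mapping.keys (e_block B :: 'f::field comp_sum) \<subseteq> set_compositions B"
proof
  fix R assume "R \<in> Poly_Mapping.keys (e_block B :: 'f comp_sum)"
  then have "(\<Sum>P\<in>{P \<in> set_compositions B. Min B \<in> hd P}.
      Poly_Mapping.lookup (Poly_Mapping.single P ((-1) ^ (length P - 1) :: 'f)) R) \<noteq> 0"
    by (simp add: in_keys_iff e_block_def lookup_sum)
  then obtain P where "P \<in> set_compositions B"
    "Poly_Mapping.lookup (Poly_Mapping.single P ((-1) ^ (length P - 1) :: 'f)) R \<noteq> 0"
    by (auto elim: sum.not_neutral_contains_not_neutral)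
  then show "R \<in> set_compositions B"
    by (auto simp: lookup_single when_def split: if_splits)
qed

lemma lookup_e_block:
  assumes "finite B" and "B \<noteq> {}"
  shows "Poly_Mapping.lookup (e_block B) [B] = 1"
proof -
  have fin: "finite {P \<in> set_compositions B. Min B \<in> hd P}"
    using finite_set_compositions[OF assms(1)] by simp
  have "Poly_Mapping.lookup (e_block B :: 'a comp_sum) [B]
      = (\<Sum>P\<in>{P \<in> set_compositions B. Min B \<in> hd P}. if P = [B] then 1 else 0)"
    unfolding e_block_def lookup_sum by (rule sum.cong) (auto simp: lookup_single when_def)
  also have "\<dots> = 1"
    using assms fin by (simp add: sum.delta Cons_in_set_compositions)
  finally show ?thesis .
qed

lemma wedge_basis_single: "wedge (basis P) (Poly_Mapping.single R c) = Poly_Mapping.single (comp_wedge P R) c"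
  by (metis scl_basis wedge_basis wedge_scl_right)

text \<open>
  The cancellation that the idempotent of a block is made for. Take \<open>Y = p \<inter> B\<close> for a block \<open>p\<close> of \<open>P\<close>
  that meets \<open>B\<close> but misses its minimum. Splitting at \<open>Y\<close> changes the sign of a term, and not its
  product with \<open>P\<close>, which separates \<open>Y\<close> from the rest of \<open>B\<close> anyway.
\<close>

lemma wedge_e_block_cut:
  assumes fin: "finite B" and ne: "B \<noteq> {}" and BA: "B \<subseteq> A" and P: "P \<in> set_compositions A"
    and cut: "\<not> (\<exists>p\<in>set P. B \<subseteq> p)"
  shows "wedge (basis P) (e_block B :: 'f::field comp_sum) = 0"
proof -
  note * = set_compositionsD[OF P]
  define b where "b = Min B"
  have b: "b \<in> B" using fin ne by (simp add: b_def)
  then obtain p0 where p0: "p0 \<in> set P" "b \<in> p0" using BA *(2) by blast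
  with cut obtain x where x: "x \<in> B" "x \<notin> p0" by blast
  then obtain p where p: "p \<in> set P" "x \<in> p" using BA *(2) by blast
  \<comment> \<open>The minimum lies in the block \<open>p0\<close>, and \<open>p\<close> is another block that meets \<open>B\<close>.\<close>
  define Y where "Y = p \<inter> B"
  have "p \<inter> p0 = {}" using *(4)[OF p(1) p0(1)] p x by blast
  then have bY: "b \<notin> Y" and Y: "Y \<inter> B \<noteq> {}" using p0 p x by (auto simp: Y_def)
  define S where "S = {R \<in> set_compositions B. b \<in> hd R}"
  define g :: "nat set list \<Rightarrow> 'f comp_sum"
    where "g R = Poly_Mapping.single (comp_wedge P R) ((-1) ^ (length R - 1))" for R
  have finS: "finite S"
    using finite_set_compositions[OF fin] by (simp add: S_def)
  have "wedge (basis P) (e_block B :: 'f comp_sum) = (\<Sum>R\<in>S. wedge (basis P) (Poly_Mapping.single R ((-1) ^ (length R - 1))))"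
    by (simp add: e_block_def wedge_sum_right S_def b_def)
  also have "\<dots> = sum g S"
    by (rule sum.cong) (simp_all add: g_def wedge_basis_single)
  also have "\<dots> = sum g {R \<in> S. first_pure Y R} + sum g {R \<in> S. \<not> first_pure Y R}"
    using finS by (subst sum.union_disjoint[symmetric]) (auto intro: sum.cong)
  also have "sum g {R \<in> S. first_pure Y R} = (\<Sum>R\<in>{R \<in> S. \<not> first_pure Y R}. - g R)"
  proof (rule sum.reindex_bij_witness[where i = "split_at Y" and j = "merge_at Y"])
    fix R assume "R \<in> {R \<in> S. first_pure Y R}"
    then have R: "R \<in> set_compositions B" "first_pure Y R" "b \<in> hd R" by (auto simp: S_def)
    \<comment> \<open>The head contains the minimum, so it is not the first block that meets \<open>Y\<close>, as that one is
      contained in \<open>Y\<close>.\<close>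
    have "hd R \<inter> Y = {}"
      using R bY b set_compositionsD(2)[OF R(1)] by (cases R) (auto split: if_splits)
    from merge_at_pure[OF R(1,2) Y this] R(3)
    show "split_at Y (merge_at Y R) = R" "merge_at Y R \<in> {R \<in> S. \<not> first_pure Y R}"
      by (auto simp: S_def)
    then have "merge_at Y R \<in> set_compositions B" "\<not> first_pure Y (merge_at Y R)"
      by (auto simp: S_def)
    from split_at_mixed[OF this] \<open>split_at Y (merge_at Y R) = R\<close>
    have len: "length R = Suc (length (merge_at Y R))" by simp
    have "merge_at Y R \<noteq> []"
      using \<open>\<not> first_pure Y (merge_at Y R)\<close> by (cases "merge_at Y R") auto
    then have "(- 1 :: 'f) ^ (length R - 1) = - ((-1) ^ (length (merge_at Y R) - 1))"
      unfolding len by (cases "length (merge_at Y R)") auto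
    moreover have "comp_wedge P (split_at Y (merge_at Y R)) = comp_wedge P (merge_at Y R)"
      unfolding comp_wedge_concat
    proof (intro arg_cong[where f = concat] map_cong refl trace_split_at)
      show "\<Union>(set (merge_at Y R)) \<subseteq> B"
        using set_compositionsD(2)[OF \<open>merge_at Y R \<in> set_compositions B\<close>] by simp
      show "q \<inter> B = Y \<or> q \<inter> Y = {}" if "q \<in> set P" for q
        using *(4)[OF that p(1)] by (auto simp: Y_def)
    qed
    ultimately show "- g (merge_at Y R) = g R"
      using \<open>split_at Y (merge_at Y R) = R\<close> by (simp add: g_def single_uminus)
  next
    fix R assume "R \<in> {R \<in> S. \<not> first_pure Y R}"
    then have R: "R \<in> set_compositions B" "\<not> first_pure Y R" "b \<in> hd R" by (auto simp: S_def)
    from split_at_mixed[OF R(1,2)] R(3) bY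
    show "merge_at Y (split_at Y R) = R" "split_at Y R \<in> {R \<in> S. first_pure Y R}"
      by (auto simp: S_def)
  qed
  finally show ?thesis
    by (simp add: sum_negf)
qed

section \<open>Products of Lie brackets\<close>

text \<open>
  Iterated brackets are represented by binary trees rather than by their values, since the number and
  the supports of the factors of a product cannot be read off its value.
\<close>

datatype bracketing = Letter "nat set" | Bracket bracketing bracketing

primrec letters :: "bracketing \<Rightarrow> nat set list" where
  "letters (Letter B) = [B]"
| "letters (Bracket s t) = letters s @ letters t"

definition support :: "bracketing \<Rightarrow> nat set" where
  "support t = \<Union>(set (letters t))"

primrec lie :: "bracketing \<Rightarrow> 'f::field comp_sum" where
  "lie (Letter B) = e_block B"
| "lie (Bracket s t) = vee (lie s) (lie t) - vee (lie t) (lie s)"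

definition lie_prod :: "bracketing list \<Rightarrow> 'f::field comp_sum" where
  "lie_prod ts = foldr vee (map lie ts) (basis [])"

lemma support_simps [simp]:
  "support (Letter B) = B" "support (Bracket s t) = support s \<union> support t"
  by (simp_all add: support_def)

lemma letters_nonempty [simp]: "letters t \<noteq> []"
  by (induction t) auto

lemma lie_prod_Nil [simp]: "lie_prod [] = basis []"
  and lie_prod_Cons [simp]: "lie_prod (t # ts) = vee (lie t) (lie_prod ts)"
  by (simp_all add: lie_prod_def)

lemma lie_prod_append: "lie_prod (ts @ us) = vee (lie_prod ts) (lie_prod us)"
  by (induction ts) (simp_all add: vee_assoc)

lemma e_comp_lie_prod: "e_comp Q = lie_prod (map Letter Q)"
  by (simp add: e_comp_def lie_prod_def comp_def)

lemma lie_prod_bracket: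
  "lie_prod (as @ Bracket s t # bs) = lie_prod (as @ s # t # bs) - lie_prod (as @ t # s # bs)"
  by (simp add: lie_prod_append vee_diff_left vee_diff_right vee_assoc)

lemma keys_vee_set_compositions:
  assumes "Poly_Mapping.keys x \<subseteq> set_compositions U" and "Poly_Mapping.keys y \<subseteq> set_compositions V"
  shows "Poly_Mapping.keys (vee x y) \<subseteq> set_compositions (U \<union> V)"
proof
  fix R assume "R \<in> Poly_Mapping.keys (vee x y)"
  then obtain P Q where R: "R = P @ Q" and P: "P \<in> set_compositions U" and Q: "Q \<in> set_compositions V"
    and disj: "\<Union>(set P) \<inter> \<Union>(set Q) = {}"
    using keys_vee[of x y] assms by blast
  then have "U \<inter> V = {}"
    by (simp add: set_compositionsD(2)[OF P] set_compositionsD(2)[OF Q])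
  then show "R \<in> set_compositions (U \<union> V)"
    using append_in_set_compositions[OF P Q] R by simp
qed

lemma keys_lie: "Poly_Mapping.keys (lie t :: 'f::field comp_sum) \<subseteq> set_compositions (support t)"
proof (induction t)
  case (Letter B)
  then show ?case by (simp add: keys_e_block)
next
  case (Bracket s t)
  have "Poly_Mapping.keys (vee (lie t) (lie s) :: 'f comp_sum) \<subseteq> set_compositions (support s \<union> support t)"
    using keys_vee_set_compositions[OF Bracket.IH(2,1)] by (simp add: Un_commute)
  with keys_vee_set_compositions[OF Bracket.IH] show ?case
    using keys_minus_subset[of "vee (lie s) (lie t) :: 'f comp_sum" "vee (lie t) (lie s)"] by auto
qed

lemma keys_lie_prod:
  "Poly_Mapping.keys (lie_prod ts) \<subseteq> set_compositions (\<Union>t\<in>set ts. support t)"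
proof (induction ts)
  case (Cons t ts)
  then show ?case
    using keys_vee_set_compositions[OF keys_lie Cons.IH] by simp
qed simp

subsection \<open>The action of set compositions\<close>

text \<open>
  By \<open>comp_wedge_inner\<close>, the factor \<open>y\<close> can be replaced by \<open>P \<and> y = 0\<close>. The blocks of \<open>S\<close> have to stay
  inside \<open>A\<close> because otherwise \<open>P \<and> S\<close> loses elements, and may be disjoint from the other factors where
  \<open>S\<close> is not.
\<close>

lemma wedge_vee_zero:
  assumes P: "P \<in> set_compositions A"
    and keys: "\<And>S. S \<in> Poly_Mapping.keys y \<Longrightarrow> \<Union>(set S) \<subseteq> A"
    and zero: "wedge (basis P) y = 0"
  shows "wedge (basis P) (vee x (vee y z)) = (0 :: 'f::field comp_sum)"
proof -
  have "wedge (basis P) (vee x (vee y z)) = wedge (basis P) (vee x (vee (wedge (basis P) y) z))"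
  proof (rule lin_eq_on_keys[where x = y])
    fix S assume "S \<in> Poly_Mapping.keys y"
    then have S: "\<Union>(set (comp_wedge P S)) = \<Union>(set S)"
      using keys[of S] by (auto simp: Union_comp_wedge set_compositionsD(2)[OF P])
    show "wedge (basis P) (vee x (vee (basis S) z))
        = wedge (basis P) (vee x (vee (wedge (basis P) (basis S)) z))"
    proof (rule lin_eq_on_keys[where x = x])
      fix X
      show "wedge (basis P) (vee (basis X) (vee (basis S) z))
          = wedge (basis P) (vee (basis X) (vee (wedge (basis P) (basis S)) z))"
      proof (rule lin_eq_on_keys[where x = z])
        fix Z
        show "wedge (basis P) (vee (basis X) (vee (basis S) (basis Z)))
            = wedge (basis P) (vee (basis X) (vee (wedge (basis P) (basis S)) (basis Z :: 'f comp_sum)))"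
          using S comp_wedge_inner[OF P, of X S Z] by (simp add: vee_basis)
      qed (intro lin_comp[OF lin_wedge_right] lin_comp[OF lin_vee_right] lin_vee_right)+
    qed (intro lin_comp[OF lin_wedge_right] lin_vee_left)+
  qed (intro lin_comp[OF lin_wedge_right] lin_comp[OF lin_vee_right] lin_comp[OF lin_vee_left]
      lin_vee_left lin_wedge_right)+
  then show ?thesis
    by (simp add: zero)
qed

text \<open>
  Each block of \<open>P\<close> meets at most one of the two factors, so their relative order is forgotten.
\<close>

lemma wedge_vee_commute:
  assumes P: "P \<in> set_compositions A" and pq: "p \<in> set P" "q \<in> set P" "p \<noteq> q"
    and x: "\<And>X. X \<in> Poly_Mapping.keys x \<Longrightarrow> \<Union>(set X) \<subseteq> p"
    and y: "\<And>Y. Y \<in> Poly_Mapping.keys y \<Longrightarrow> \<Union>(set Y) \<subseteq> q"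
  shows "wedge (basis P) (vee x y) = wedge (basis P) (vee y x :: 'f::field comp_sum)"
proof (rule lin_eq_on_keys[where x = x])
  fix X assume X: "X \<in> Poly_Mapping.keys x"
  show "wedge (basis P) (vee (basis X) y) = wedge (basis P) (vee y (basis X))"
  proof (rule lin_eq_on_keys[where x = y])
    fix Y assume Y: "Y \<in> Poly_Mapping.keys y"
    have "trace r X = [] \<or> trace r Y = []" if "r \<in> set P" for r
      using x[OF X] y[OF Y] set_compositionsD(4)[OF P] that pq unfolding trace_eq_Nil_iff by blast
    then have "trace r (X @ Y) = trace r (Y @ X)" if "r \<in> set P" for r
      using that by fastforce
    then have "comp_wedge P (X @ Y) = comp_wedge P (Y @ X)"
      unfolding comp_wedge_concat by (intro arg_cong[where f = concat] map_cong refl) blast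
    then show "wedge (basis P) (vee (basis X) (basis Y)) = wedge (basis P) (vee (basis Y) (basis X :: 'f comp_sum))"
      by (simp add: vee_basis Int_commute)
  qed (intro lin_comp[OF lin_wedge_right] lin_vee_left lin_vee_right)+
qed (intro lin_comp[OF lin_wedge_right] lin_vee_left lin_vee_right)+

text \<open>
  If \<open>P\<close> cuts one of the two parts of a bracket, that part is killed, and so are both products of the
  parts. Otherwise the parts lie in different blocks of \<open>P\<close>, which then does not distinguish the two
  products.
\<close>

lemma wedge_lie_cut:
  assumes A: "finite A" and P: "P \<in> set_compositions A"
    and "{} \<notin> set (letters t)" and "support t \<subseteq> A" and "\<not> (\<exists>p\<in>set P. support t \<subseteq> p)"
  shows "wedge (basis P) (lie t) = (0 :: 'f::field comp_sum)"
  using assms(3-)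
proof (induction t)
  case (Letter B)
  then show ?case
    using wedge_e_block_cut[OF finite_subset[OF _ A] _ _ P, of B] by auto
next
  case (Bracket s t)
  have keys: "\<Union>(set S) \<subseteq> support u" if "S \<in> Poly_Mapping.keys (lie u :: 'f comp_sum)" for S u
    using set_compositionsD(2)[OF set_mp[OF keys_lie that]] by simp
  have zero: "wedge (basis P) (vee (lie u) (lie v)) = (0 :: 'f comp_sum)"
    "wedge (basis P) (vee (lie v) (lie u)) = (0 :: 'f comp_sum)"
    if "wedge (basis P) (lie u) = (0 :: 'f comp_sum)" "support u \<subseteq> A" for u v
  proof -
    have "\<Union>(set S) \<subseteq> A" if "S \<in> Poly_Mapping.keys (lie u :: 'f comp_sum)" for S
      using keys[OF that] \<open>support u \<subseteq> A\<close> by (rule subset_trans)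
    note wedge_vee_zero[OF P this that(1)]
    from this[of "basis []" "lie v"] this[of "lie v" "basis []"]
    show "wedge (basis P) (vee (lie u) (lie v)) = (0 :: 'f comp_sum)"
      "wedge (basis P) (vee (lie v) (lie u)) = (0 :: 'f comp_sum)"
      by simp_all
  qed
  show ?case
  proof (cases "(\<exists>p\<in>set P. support s \<subseteq> p) \<and> (\<exists>p\<in>set P. support t \<subseteq> p)")
    case True
    then obtain p q where pq: "p \<in> set P" "support s \<subseteq> p" "q \<in> set P" "support t \<subseteq> q" by blast
    then have "p \<noteq> q" using Bracket.prems by auto
    have "wedge (basis P) (vee (lie s) (lie t)) = wedge (basis P) (vee (lie t) (lie s) :: 'f comp_sum)"
      by (rule wedge_vee_commute[OF P pq(1,3) \<open>p \<noteq> q\<close>])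
        (erule subset_trans[OF keys pq(2)] subset_trans[OF keys pq(4)])+
    then show ?thesis
      by (simp add: wedge_diff_right)
  next
    case False
    then have "wedge (basis P) (lie s) = (0 :: 'f comp_sum) \<or> wedge (basis P) (lie t) = (0 :: 'f comp_sum)"
      using Bracket by auto
    then show ?thesis
      using zero[of s t] zero[of t s] Bracket.prems by (auto simp: wedge_diff_right)
  qed
qed

lemma append_set_compositionsD:
  assumes "P @ Q \<in> set_compositions A"
  shows "P \<in> set_compositions (\<Union>(set P))" and "Q \<in> set_compositions (A - \<Union>(set P))"
    and "\<Union>(set P) \<subseteq> A"
  using assms
proof (induction P arbitrary: A)
  case Nil
  {
    case 1 then show ?case by simp
  next
    case 2 then show ?case by simp
  next
    case 3 then show ?case by simp
  }
next
  case (Cons p P)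
  {
    case 1
    then have PQ: "P @ Q \<in> set_compositions (A - p)" and p: "p \<noteq> {}" by (auto simp: Cons_in_set_compositions)
    from Cons.IH(3)[OF PQ] have "\<Union>(set (p # P)) - p = \<Union>(set P)" by auto
    then show ?case using Cons.IH(1)[OF PQ] p by (auto simp: Cons_in_set_compositions)
  next
    case 2
    then have PQ: "P @ Q \<in> set_compositions (A - p)" by (auto simp: Cons_in_set_compositions)
    have "A - p - \<Union>(set P) = A - \<Union>(set (p # P))" by auto
    then show ?case using Cons.IH(2)[OF PQ] by simp
  next
    case 3
    then have PQ: "P @ Q \<in> set_compositions (A - p)" and "p \<subseteq> A" by (auto simp: Cons_in_set_compositions)
    then show ?case using Cons.IH(3)[OF PQ] by auto
  }
qed

lemma supports_in_set_compositions:
  "concat (map letters ts) \<in> set_compositions A \<Longrightarrow> map support ts \<in> set_compositions A"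
proof (induction ts arbitrary: A)
  case (Cons t ts)
  then have *: "letters t @ concat (map letters ts) \<in> set_compositions A" by simp
  note D = append_set_compositionsD[OF this]
  have "hd (letters t) \<in> set (letters t)" by simp
  then have "hd (letters t) \<noteq> {}" "hd (letters t) \<subseteq> support t"
    using set_compositionsD(3)[OF D(1)] unfolding support_def by blast+
  then have "support t \<noteq> {}" by auto
  then show ?case
    using D Cons.IH[of "A - support t"] by (auto simp: support_def Cons_in_set_compositions)
qed simp

lemma wedge_lie_prod_cut:
  assumes A: "finite A" and P: "P \<in> set_compositions A"
    and ts: "concat (map letters ts) \<in> set_compositions A" and cut: "\<not> map support ts \<preceq> P"
  shows "wedge (basis P) (lie_prod ts) = (0 :: 'f::field comp_sum)"
proof -
  obtain t where t: "t \<in> set ts" "\<not> (\<exists>p\<in>set P. support t \<subseteq> p)"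
    using cut by (auto simp: refines_def)
  then obtain as bs where split: "ts = as @ t # bs"
    by (meson split_list)
  have "{} \<notin> set (letters t)"
    using set_compositionsD(3)[OF ts, of "{}"] t by auto
  moreover have tA: "support t \<subseteq> A"
    using set_compositionsD(2)[OF ts] t by (auto simp: support_def)
  ultimately have "wedge (basis P) (lie t) = (0 :: 'f comp_sum)"
    by (rule wedge_lie_cut[OF A P _ _ t(2)])
  moreover have "\<Union>(set S) \<subseteq> A" if "S \<in> Poly_Mapping.keys (lie t :: 'f comp_sum)" for S
    using set_compositionsD(2)[OF set_mp[OF keys_lie that]] tA by simp
  ultimately show ?thesis
    by (simp add: split lie_prod_append wedge_vee_zero[OF P])
qed

text \<open>
  Sorting a word whose letters are already in the order of the blocks of \<open>P\<close> does nothing. The list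
  \<open>tss\<close> groups the factors by these blocks; some groups may be empty.
\<close>

lemma wedge_lie_prod_sorted:
  assumes "P \<in> set_compositions A" and "list_all2 (\<lambda>p ts. \<forall>t\<in>set ts. support t \<subseteq> p) P tss"
  shows "wedge (basis P) (lie_prod (concat tss)) = (lie_prod (concat tss) :: 'f::field comp_sum)"
proof -
  have sub: "(\<Union>t\<in>set (concat tss). support t) \<subseteq> \<Union>(set P)"
    if "list_all2 (\<lambda>p ts. \<forall>t\<in>set ts. support t \<subseteq> p) P tss" for P tss
    using that by (induction rule: list_all2_induct) auto
  have "comp_wedge P R = R" if "R \<in> Poly_Mapping.keys (lie_prod (concat tss) :: 'f comp_sum)" for R
    using assms(2,1) that
  proof (induction arbitrary: A R rule: list_all2_induct)
    case Nil
    then show ?case by simp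
  next
    case (Cons p P ts tss)
    then have P: "P \<in> set_compositions (A - p)"
      by (simp add: Cons_in_set_compositions)
    from Cons.prems(2) obtain X Y where R: "R = X @ Y"
      and X: "X \<in> Poly_Mapping.keys (lie_prod ts :: 'f comp_sum)"
      and Y: "Y \<in> Poly_Mapping.keys (lie_prod (concat tss) :: 'f comp_sum)"
      using keys_vee[of "lie_prod ts :: 'f comp_sum" "lie_prod (concat tss)"]
      by (auto simp: lie_prod_append)
    note X' = set_mp[OF keys_lie_prod X] and Y' = set_mp[OF keys_lie_prod Y]
    have Xp: "\<Union>(set X) \<subseteq> p"
      using set_compositionsD(2)[OF X'] Cons.hyps(1) by auto
    have Yp: "\<Union>(set Y) \<subseteq> \<Union>(set P)"
      using set_compositionsD(2)[OF Y'] sub[OF Cons.hyps(2)] by auto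
    have "trace p X = X"
      using Xp set_compositionsD(3)[OF X'] by (intro trace_ident) auto
    moreover have "trace p Y = []"
      using Yp set_compositionsD(2)[OF P] by (auto simp: trace_eq_Nil_iff)
    moreover have "comp_wedge P (X @ Y) = comp_wedge P Y"
    proof -
      have "trace q X = []" if "q \<in> set P" for q
        using that Xp set_compositionsD(2)[OF P] by (auto simp: trace_eq_Nil_iff)
      then show ?thesis
        unfolding comp_wedge_concat by (intro arg_cong[where f = concat] map_cong) auto
    qed
    ultimately show ?case
      using Cons.IH[OF P Y] by (simp add: R comp_wedge_Cons)
  qed
  then show ?thesis
    by - (rule lin_eq_on_keys[where f = "wedge (basis P)" and g = "\<lambda>x. x",
          OF lin_wedge_right cs.linear_ident], simp)
qed

lemma wedge_supports_lie_prod: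
  assumes "concat (map letters ts) \<in> set_compositions A"
  shows "wedge (basis (map support ts)) (lie_prod ts) = lie_prod ts"
proof -
  have "concat (map (\<lambda>t. [t]) ts) = ts"
    by (induction ts) auto
  then show ?thesis
    using wedge_lie_prod_sorted[OF supports_in_set_compositions[OF assms], of "map (\<lambda>t. [t]) ts"]
    by (simp add: list_all2_map1 list_all2_map2 list_all2_refl)
qed

subsection \<open>Leading coefficients\<close>

lemma lookup_vee:
  "Poly_Mapping.lookup (vee x y) R =
     (\<Sum>P\<in>Poly_Mapping.keys x. \<Sum>Q\<in>Poly_Mapping.keys y.
        if \<Union>(set P) \<inter> \<Union>(set Q) = {} \<and> P @ Q = R
        then Poly_Mapping.lookup x P * Poly_Mapping.lookup y Q else 0)"
  unfolding vee_def lookup_sum by (intro sum.cong refl) (simp add: lookup_single when_def)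

text \<open>
  The underlying sets determine where a word splits: a prefix with union \<open>U\<close> cannot be extended by
  non-empty sets without reaching into \<open>V\<close>.
\<close>

lemma append_eq_same_Union:
  assumes "P @ Q = P' @ Q'" and "P \<in> set_compositions U" and "P' \<in> set_compositions U"
    and "Q \<in> set_compositions V" and "Q' \<in> set_compositions V" and "U \<inter> V = {}"
  shows "P = P' \<and> Q = Q'"
proof -
  have aux: "P = P'" if "P @ Q = P' @ Q'" "P \<in> set_compositions U" "P' \<in> set_compositions U"
    "Q \<in> set_compositions V" "P' = P @ us" for P P' Q Q' us
  proof -
    have "\<Union>(set us) \<subseteq> U \<inter> V"
      using set_compositionsD(2)[OF that(3)] set_compositionsD(2)[OF that(4)] that(1,5) by auto
    then have "u = {}" if "u \<in> set us" for u
      using that assms(6) by auto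
    then have "us = []"
      using set_compositionsD(3)[OF that(3)] that(5) by (cases us) auto
    then show ?thesis using that by simp
  qed
  obtain us where us: "P' = P @ us \<or> P = P' @ us"
    using assms(1) by (auto simp: append_eq_append_conv2)
  then have "P = P'"
  proof
    assume "P' = P @ us"
    then show ?thesis by (rule aux[OF assms(1-4)])
  next
    assume "P = P' @ us"
    then show ?thesis by (rule aux[OF assms(1)[symmetric] assms(3,2,5), symmetric])
  qed
  with assms(1) show ?thesis by simp
qed

lemma lookup_vee_append:
  assumes x: "Poly_Mapping.keys x \<subseteq> set_compositions U" and y: "Poly_Mapping.keys y \<subseteq> set_compositions V"
    and disj: "U \<inter> V = {}" and P: "P \<in> set_compositions U" and Q: "Q \<in> set_compositions V"
  shows "Poly_Mapping.lookup (vee x y) (P @ Q) = Poly_Mapping.lookup x P * Poly_Mapping.lookup y Q"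
proof -
  have "Poly_Mapping.lookup (vee x y) (P @ Q) =
     (\<Sum>P'\<in>Poly_Mapping.keys x. \<Sum>Q'\<in>Poly_Mapping.keys y.
        if P' = P \<and> Q' = Q then Poly_Mapping.lookup x P * Poly_Mapping.lookup y Q else 0)"
    unfolding lookup_vee
  proof (intro sum.cong refl)
    fix P' Q' assume "P' \<in> Poly_Mapping.keys x" "Q' \<in> Poly_Mapping.keys y"
    then have P': "P' \<in> set_compositions U" and Q': "Q' \<in> set_compositions V"
      using x y by auto
    have "P' @ Q' = P @ Q \<longleftrightarrow> P' = P \<and> Q' = Q"
      using append_eq_same_Union[OF _ P' P Q' Q disj] by auto
    moreover have "\<Union>(set P') \<inter> \<Union>(set Q') = {}"
      using disj by (simp add: set_compositionsD(2)[OF P'] set_compositionsD(2)[OF Q'])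
    ultimately show "(if \<Union>(set P') \<inter> \<Union>(set Q') = {} \<and> P' @ Q' = P @ Q
        then Poly_Mapping.lookup x P' * Poly_Mapping.lookup y Q' else 0)
      = (if P' = P \<and> Q' = Q then Poly_Mapping.lookup x P * Poly_Mapping.lookup y Q else 0)"
      by simp
  qed
  also have "\<dots> = (\<Sum>P'\<in>Poly_Mapping.keys x. if P' = P then
      (\<Sum>Q'\<in>Poly_Mapping.keys y. if Q' = Q then Poly_Mapping.lookup x P * Poly_Mapping.lookup y Q else 0) else 0)"
    by (intro sum.cong refl) auto
  also have "\<dots> = Poly_Mapping.lookup x P * Poly_Mapping.lookup y Q"
    by (auto simp: sum.delta in_keys_iff)
  finally show ?thesis .
qed

lemma lookup_vee_append_zero:
  assumes x: "Poly_Mapping.keys x \<subseteq> set_compositions U" and y: "Poly_Mapping.keys y \<subseteq> set_compositions V"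
    and disj: "U \<inter> V = {}" and P: "P \<in> set_compositions U" "P \<noteq> []" and Q: "Q \<in> set_compositions V" "Q \<noteq> []"
  shows "Poly_Mapping.lookup (vee y x) (P @ Q) = 0"
  unfolding lookup_vee
proof (intro sum.neutral ballI)
  fix Q' P' assume "Q' \<in> Poly_Mapping.keys y" "P' \<in> Poly_Mapping.keys x"
  then have Q': "Q' \<in> set_compositions V" using y by auto
  have "Q' @ P' \<noteq> P @ Q"
  proof
    assume eq: "Q' @ P' = P @ Q"
    obtain p P1 where p: "P = p # P1" using P(2) by (cases P) auto
    have "V \<noteq> {}" using Q by (cases Q) (auto simp: Cons_in_set_compositions)
    then obtain q Q1 where q: "Q' = q # Q1" using Q' by (cases Q') auto
    have "p = q" using eq p q by simp
    moreover have "p \<subseteq> U" "p \<noteq> {}" "q \<subseteq> V"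
      using P Q' p q by (auto simp: Cons_in_set_compositions)
    ultimately show False using disj by blast
  qed
  then show "(if \<Union>(set Q') \<inter> \<Union>(set P') = {} \<and> Q' @ P' = P @ Q
      then Poly_Mapping.lookup y Q' * Poly_Mapping.lookup x P' else 0) = 0"
    by simp
qed

text \<open>
  Expanding a bracket gives its letters in their original order once, with coefficient \<open>1\<close>; in the other
  terms the letters are permuted or some letter is refined. This shows that brackets are non-zero, in any
  characteristic.
\<close>

lemma lookup_lie_letters:
  assumes "letters t \<in> set_compositions (support t)" and "finite (support t)"
  shows "Poly_Mapping.lookup (lie t) (letters t) = (1 :: 'f::field)"
  using assms
proof (induction t)
  case (Letter B)
  then show ?case
    by (simp add: lookup_e_block Cons_in_set_compositions)
next
  case (Bracket s t)
  then have *: "letters s @ letters t \<in> set_compositions (support s \<union> support t)" by simp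
  note D = append_set_compositionsD[OF *, folded support_def]
  have disj: "support s \<inter> support t = {}"
    using set_compositionsD(2)[OF D(2)] by (auto simp: support_def)
  then have t: "letters t \<in> set_compositions (support t)"
    using D(2) by (simp add: Un_Diff Diff_triv Int_commute)
  have "Poly_Mapping.lookup (vee (lie s) (lie t)) (letters s @ letters t) = (1 :: 'f)"
    using lookup_vee_append[OF keys_lie keys_lie disj D(1) t, where 'a = 'f] Bracket D(1) t by simp
  moreover have "Poly_Mapping.lookup (vee (lie t) (lie s)) (letters s @ letters t) = (0 :: 'f)"
    using lookup_vee_append_zero[OF keys_lie keys_lie disj D(1) _ t, where 'a = 'f] by simp
  ultimately show ?case
    by (simp add: lookup_minus)
qed

lemma lookup_lie_prod_letters:
  assumes "concat (map letters ts) \<in> set_compositions A" and "finite A"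
  shows "Poly_Mapping.lookup (lie_prod ts) (concat (map letters ts)) = (1 :: 'f::field)"
  using assms
proof (induction ts arbitrary: A)
  case (Cons t ts)
  then have *: "letters t @ concat (map letters ts) \<in> set_compositions A" by simp
  note D = append_set_compositionsD[OF *, folded support_def]
  have U: "(\<Union>u\<in>set ts. support u) = A - support t"
  proof -
    have "(\<Union>u\<in>set ts. support u) = \<Union>(set (concat (map letters ts)))"
      by (auto simp: support_def)
    then show ?thesis
      using set_compositionsD(2)[OF D(2)] by simp
  qed
  have keys: "Poly_Mapping.keys (lie_prod ts :: 'f comp_sum) \<subseteq> set_compositions (A - support t)"
    using keys_lie_prod[of ts] unfolding U .
  have "Poly_Mapping.lookup (lie_prod (t # ts)) (concat (map letters (t # ts)))
     = Poly_Mapping.lookup (lie t) (letters t)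
       * (Poly_Mapping.lookup (lie_prod ts) (concat (map letters ts)) :: 'f)"
    using lookup_vee_append[OF keys_lie keys Diff_disjoint D(1,2)] by simp
  also have "\<dots> = 1"
    using lookup_lie_letters[OF D(1) finite_subset[OF D(3) Cons.prems(2)]] Cons.IH[OF D(2)] Cons.prems(2)
    by simp
  finally show ?case .
qed simp

section \<open>Left ideals\<close>

text \<open>
  Closure under the basis elements and linear combinations is easier to check than closure under all
  of the algebra, and equivalent to it by \<open>left_ideal_wedge\<close>.
\<close>

definition left_ideal :: "nat set \<Rightarrow> 'f::field comp_sum set \<Rightarrow> bool" where
  "left_ideal A C \<longleftrightarrow> cs.subspace C \<and> C \<subseteq> carrier (comp_algebra A) \<and>
     (\<forall>P\<in>set_compositions A. \<forall>x\<in>C. wedge (basis P) x \<in> C)"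

lemma carrier_comp_algebra [simp]: "carrier (comp_algebra A) = {x. Poly_Mapping.keys x \<subseteq> set_compositions A}"
  by (simp add: comp_algebra_def)

lemma subspace_keys: "cs.subspace {x :: 'f::field comp_sum. Poly_Mapping.keys x \<subseteq> S}"
proof -
  have "{x :: 'f comp_sum. Poly_Mapping.keys x \<subseteq> S} = {x. \<forall>R. R \<notin> S \<longrightarrow> Poly_Mapping.lookup x R = 0}"
    by (auto simp: in_keys_iff)
  then show ?thesis
    by (auto intro!: cs.subspaceI simp: lookup_add)
qed

lemma left_ideal_wedge:
  assumes "left_ideal A C" and "Poly_Mapping.keys r \<subseteq> set_compositions A" and "x \<in> C"
  shows "wedge r x \<in> C"
  by (rule lin_image_subspace[OF lin_wedge_left]) (use assms in \<open>auto simp: left_ideal_def\<close>)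

lemma left_ideal_algebra: "left_ideal A (carrier (comp_algebra A :: 'f::field comp_sum ring))"
  unfolding left_ideal_def carrier_comp_algebra
proof (intro conjI ballI)
  fix P and x :: "'f comp_sum"
  assume "P \<in> set_compositions A" and "x \<in> {x. Poly_Mapping.keys x \<subseteq> set_compositions A}"
  then show "wedge (basis P) x \<in> {x. Poly_Mapping.keys x \<subseteq> set_compositions A}"
    by - (rule lin_image_subspace[OF lin_wedge_right subspace_keys],
        use comp_wedge_in_set_compositions[of P A _ A] in auto)
qed (simp_all add: subspace_keys)

lemma left_ideal_sum:
  assumes "left_ideal A K" and "left_ideal A L"
  shows "left_ideal A {x + y | x y. x \<in> K \<and> y \<in> L}"
proof -
  have "Poly_Mapping.keys (x + y) \<subseteq> set_compositions A" if "x \<in> K" "y \<in> L" for x y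
    using that assms keys_add[of x y] unfolding left_ideal_def carrier_comp_algebra by blast
  moreover have "wedge (basis P) (x + y) \<in> {x + y | x y. x \<in> K \<and> y \<in> L}"
    if "P \<in> set_compositions A" "x \<in> K" "y \<in> L" for P x y
    using that assms unfolding left_ideal_def wedge_add_right by blast
  moreover have "cs.subspace {x + y | x y. x \<in> K \<and> y \<in> L}"
    by (rule cs.subspace_sums) (use assms in \<open>simp_all add: left_ideal_def\<close>)
  ultimately show ?thesis
    unfolding left_ideal_def carrier_comp_algebra by blast
qed

lemma left_ideal_image:
  fixes w :: "'f::field comp_sum"
  assumes C: "left_ideal A C" and w: "Poly_Mapping.keys w \<subseteq> set_compositions A"
  shows "left_ideal A ((\<lambda>x. wedge x w) ` C)" (is "left_ideal A ?Y")
  unfolding left_ideal_def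
proof (intro conjI ballI)
  have Cs: "cs.subspace C" using C by (simp add: left_ideal_def)
  show "cs.subspace ?Y"
  proof (rule cs.subspaceI)
    show "0 \<in> ?Y" using cs.subspace_0[OF Cs] by force
    show "x + y \<in> ?Y" if "x \<in> ?Y" "y \<in> ?Y" for x y
      using that by (auto simp: cs.subspace_add[OF Cs] simp flip: wedge_add_left)
    show "scl c x \<in> ?Y" if "x \<in> ?Y" for c x
      using that by (auto simp: cs.subspace_scale[OF Cs] simp flip: wedge_scl_left)
  qed
  show "?Y \<subseteq> carrier (comp_algebra A)"
    using left_ideal_wedge[OF left_ideal_algebra, of _ A w] C w by (auto simp: left_ideal_def)
  show "wedge (basis P) y \<in> ?Y" if "P \<in> set_compositions A" "y \<in> ?Y" for P y
    using that C by (auto intro!: imageI simp: left_ideal_def simp flip: wedge_assoc)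
qed

section \<open>The filtration by the number of Lie factors\<close>

text \<open>
  The letters are recorded as a multiset so that a factor can be removed from a product and put back
  without any condition of disjointness. Counting strictly fewer than \<open>m\<close> factors makes \<open>m = 0\<close> the zero
  space and lets set compositions of length at least \<open>m\<close> act as zero.
\<close>

definition lie_span :: "nat set multiset \<Rightarrow> nat \<Rightarrow> 'f::field comp_sum set" where
  "lie_span M m = cs.span {lie_prod ts | ts. mset (concat (map letters ts)) = M \<and> length ts < m}"

lemma subspace_lie_span: "cs.subspace (lie_span M m)"
  by (simp add: lie_span_def)

lemma lie_prod_in_lie_span:
  "mset (concat (map letters ts)) = M \<Longrightarrow> length ts < m \<Longrightarrow> lie_prod ts \<in> lie_span M m"
  unfolding lie_span_def by (rule cs.span_base) blast

lemma lie_span_mono: "m \<le> m' \<Longrightarrow> lie_span M m \<subseteq> lie_span M m'"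
  unfolding lie_span_def by (rule cs.span_mono) fastforce

lemma lin_lie_span:
  assumes "lin f" and "cs.subspace S" and "x \<in> lie_span M m"
    and "\<And>ts. mset (concat (map letters ts)) = M \<Longrightarrow> length ts < m \<Longrightarrow> f (lie_prod ts) \<in> S"
  shows "f x \<in> S"
  by (rule lin_span_subset[OF assms(1,2) _ assms(3)[unfolded lie_span_def]]) (use assms(4) in blast)

lemma vee_lie_in_lie_span:
  assumes "x \<in> lie_span M m"
  shows "vee (lie t) x \<in> (lie_span (mset (letters t) + M) (Suc m) :: 'f::field comp_sum set)"
proof (rule lin_lie_span[OF lin_vee_right subspace_lie_span assms])
  fix ts assume "mset (concat (map letters ts)) = M" and "length ts < m"
  then show "vee (lie t) (lie_prod ts) \<in> (lie_span (mset (letters t) + M) (Suc m) :: 'f comp_sum set)"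
    using lie_prod_in_lie_span[of "t # ts" "mset (letters t) + M" "Suc m", where 'a = 'f] by simp
qed

lemma lie_prod_move_factor:
  "lie_prod (t # as @ bs) - lie_prod (as @ t # bs)
     \<in> (lie_span (mset (concat (map letters (t # as @ bs)))) (length (t # as @ bs)) :: 'f::field comp_sum set)"
proof (induction as)
  case Nil
  then show ?case by (simp add: cs.subspace_0[OF subspace_lie_span])
next
  case (Cons a as)
  let ?r = "as @ bs" and ?M = "mset (concat (map letters (t # (a # as) @ bs)))"
  have "lie_prod (Bracket t a # ?r) \<in> (lie_span ?M (length (t # (a # as) @ bs)) :: 'f comp_sum set)"
    by (rule lie_prod_in_lie_span) simp_all
  moreover have "vee (lie a) (lie_prod (t # ?r) - lie_prod (as @ t # bs))
      \<in> (lie_span ?M (length (t # (a # as) @ bs)) :: 'f comp_sum set)"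
    using vee_lie_in_lie_span[OF Cons.IH, of a] by (simp add: ac_simps)
  moreover have "lie_prod (t # (a # as) @ bs) - lie_prod ((a # as) @ t # bs)
      = lie_prod (Bracket t a # ?r) + vee (lie a) (lie_prod (t # ?r) - lie_prod (as @ t # bs) :: 'f comp_sum)"
    using lie_prod_bracket[of "[]" t a ?r, where 'a = 'f] by (simp add: vee_diff_right del: lie.simps)
  ultimately show ?case
    by (metis cs.subspace_add[OF subspace_lie_span])
qed

lemma mset_concat_letters:
  "mset ts = mset us \<Longrightarrow> mset (concat (map letters ts)) = mset (concat (map letters us))"
  by (metis mset_concat mset_map sum_mset_sum_list map_map)

text \<open>
  Moving a factor past its neighbour costs the product in which the two are replaced by their bracket,
  which has one factor less.
\<close>

lemma lie_prod_permute:
  assumes "mset ts = mset us"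
  shows "lie_prod ts - lie_prod us \<in> (lie_span (mset (concat (map letters ts))) (length ts) :: 'f::field comp_sum set)"
  using assms
proof (induction ts arbitrary: us)
  case Nil
  then show ?case by (simp add: cs.subspace_0[OF subspace_lie_span])
next
  case (Cons t ts)
  then have "t \<in> set us" by (metis list.set_intros(1) mset_eq_setD)
  then obtain as bs where us: "us = as @ t # bs" by (meson split_list)
  then have perm: "mset ts = mset (as @ bs)" using Cons.prems by simp
  let ?M = "mset (concat (map letters (t # ts)))"
  have "vee (lie t) (lie_prod ts - lie_prod (as @ bs)) \<in> (lie_span ?M (length (t # ts)) :: 'f comp_sum set)"
    using vee_lie_in_lie_span[OF Cons.IH[OF perm], of t] by simp
  moreover have "lie_prod (t # as @ bs) - lie_prod us \<in> (lie_span ?M (length (t # ts)) :: 'f comp_sum set)"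
    using lie_prod_move_factor[of t as bs] mset_concat_letters[OF perm] us mset_eq_length[OF perm]
    by simp
  moreover have "lie_prod (t # ts) - lie_prod us
      = vee (lie t) (lie_prod ts - lie_prod (as @ bs)) + (lie_prod (t # as @ bs) - lie_prod us :: 'f comp_sum)"
    by (simp add: vee_diff_right)
  ultimately show ?case
    by (metis cs.subspace_add[OF subspace_lie_span])
qed

lemma Min_inj_on_blocks:
  assumes "finite A" and P: "P \<in> set_compositions A"
  shows "inj_on Min (set P)"
proof (rule inj_onI)
  fix p q assume pq: "p \<in> set P" "q \<in> set P" "Min p = Min q"
  have "Min p \<in> p" if "p \<in> set P" for p
    using set_compositionsD(2,3)[OF P] that \<open>finite A\<close> by (metis Min_in finite_subset Union_upper)
  from this[OF pq(1)] this[OF pq(2)] show "p = q"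
    using set_compositionsD(4)[OF P pq(1,2)] pq(3) by auto
qed

lemma increasing_set_compositions_unique:
  assumes "finite A" and U: "U \<in> increasing_set_compositions A" and V: "V \<in> increasing_set_compositions A"
    and "set U = set V"
  shows "U = V"
proof -
  have U': "U \<in> set_compositions A" using U by (simp add: increasing_set_compositions_def)
  have "map Min U = map Min V"
    using U V \<open>set U = set V\<close> by (intro strict_sorted_equal) (auto simp: increasing_set_compositions_def)
  moreover have "inj_on Min (set U)"
    by (rule Min_inj_on_blocks[OF \<open>finite A\<close> U'])
  ultimately show ?thesis
    using \<open>set U = set V\<close> by (metis map_inj_on Un_absorb)
qed

text \<open>
  Grouping a list by the blocks of \<open>P\<close> is a rearrangement. It is needed with \<open>g\<close> the support of a
  bracketing and with \<open>g\<close> the identity.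
\<close>

lemma mset_concat_filter_blocks:
  assumes P: "P \<in> set_compositions A"
    and "\<And>t. t \<in> set ts \<Longrightarrow> g t \<noteq> {} \<and> (\<exists>p\<in>set P. g t \<subseteq> p)"
  shows "mset (concat (map (\<lambda>p. filter (\<lambda>t. g t \<subseteq> p) ts) P)) = mset ts"
proof -
  note D = set_compositionsD[OF P]
  have "mset (concat (map (\<lambda>p. filter (\<lambda>t. g t \<subseteq> p) ts) P))
      = (\<Sum>p\<in>set P. mset (filter (\<lambda>t. g t \<subseteq> p) ts))"
    using D(1) by (simp add: mset_concat comp_def sum_list_distinct_conv_sum_set)
  also have "\<dots> = mset ts"
    using assms(2)
  proof (induction ts)
    case (Cons t ts)
    then obtain p where p: "p \<in> set P" "g t \<subseteq> p" "g t \<noteq> {}" by auto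
    have "(\<Sum>q\<in>set P. mset (filter (\<lambda>u. g u \<subseteq> q) (t # ts)))
        = (\<Sum>q\<in>set P. (if q = p then {#t#} else {#}) + mset (filter (\<lambda>u. g u \<subseteq> q) ts))"
      using p D(4)[OF p(1)] by (intro sum.cong refl) auto
    also have "\<dots> = {#t#} + mset ts"
      using Cons p by (simp add: sum.distrib)
    finally show ?case by simp
  qed simp
  finally show ?thesis .
qed

locale composition =
  fixes A :: "nat set" and Q :: "nat set list"
  assumes finite_A: "finite A" and Q: "Q \<in> set_compositions A"
begin

lemma bracketing_in_set_compositions:
  assumes "mset (concat (map letters ts)) = mset Q"
  shows "concat (map letters ts) \<in> set_compositions A"
  using Q mset_eq_setD[OF assms] mset_eq_imp_distinct_iff[OF assms] by (simp add: set_compositions_def)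

lemmas supports_composition = supports_in_set_compositions[OF bracketing_in_set_compositions]

lemma length_bracketing_le:
  assumes "mset (concat (map letters ts)) = mset Q"
  shows "length ts \<le> length Q"
proof -
  have "length ts \<le> length (concat (map letters ts))"
  proof (induction ts)
    case (Cons t ts)
    have "1 \<le> length (letters t)" by (simp add: Suc_le_eq)
    with Cons show ?case by simp
  qed simp
  then show ?thesis using mset_eq_length[OF assms] by simp
qed

text \<open>
  With fewer factors than \<open>P\<close> has blocks, some factor is cut, as otherwise \<open>P\<close> would be coarser than
  the composition formed by the supports.
\<close>

lemma wedge_lie_span_long:
  assumes P: "P \<in> set_compositions A" and "m \<le> length P" and "x \<in> lie_span (mset Q) m"
  shows "wedge (basis P) x = 0"
proof -
  have "wedge (basis P) x \<in> {0}"
  proof (rule lin_lie_span[OF lin_wedge_right _ assms(3)])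
    fix ts assume ts: "mset (concat (map letters ts)) = mset Q" "length ts < m"
    have "\<not> map support ts \<preceq> P"
      using refines_length(1)[OF supports_composition[OF ts(1)] P] ts(2) \<open>m \<le> length P\<close> by auto
    then show "wedge (basis P) (lie_prod ts) \<in> {0}"
      using wedge_lie_prod_cut[OF finite_A P bracketing_in_set_compositions[OF ts(1)]] by simp
  qed simp
  then show ?thesis by simp
qed

lemma exists_sorted_permutation:
  assumes ts: "mset (concat (map letters ts)) = mset Q" and P: "P \<in> set_compositions A"
    and le: "map support ts \<preceq> P"
  shows "\<exists>us. mset us = mset ts \<and> wedge (basis P) (lie_prod us) = (lie_prod us :: 'f::field comp_sum)"
proof (intro exI conjI)
  let ?us = "map (\<lambda>p. filter (\<lambda>t. support t \<subseteq> p) ts) P"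
  show "mset (concat ?us) = mset ts"
    using le set_compositionsD(3)[OF supports_composition[OF ts]]
    by (intro mset_concat_filter_blocks[OF P]) (auto simp: refines_def)
  show "wedge (basis P) (lie_prod (concat ?us)) = (lie_prod (concat ?us) :: 'f comp_sum)"
    by (rule wedge_lie_prod_sorted[OF P]) (simp add: list_all2_map2 list_all2_refl)
qed

text \<open>
  The action of \<open>P\<close> is computed only on products in sorted order. By induction on \<open>m\<close> this is enough:
  the difference between a product and its sorted rearrangement has fewer factors.
\<close>

lemma wedge_in_lie_span:
  assumes P: "P \<in> set_compositions A" and "x \<in> lie_span (mset Q) m"
  shows "wedge (basis P) x \<in> (lie_span (mset Q) m :: 'f::field comp_sum set)"
  using assms(2)
proof (induction m arbitrary: x)
  case 0
  then show ?case by (simp add: lie_span_def)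
next
  case (Suc m)
  show ?case
  proof (rule lin_lie_span[OF lin_wedge_right subspace_lie_span Suc.prems])
    fix ts assume ts: "mset (concat (map letters ts)) = mset Q" "length ts < Suc m"
    show "wedge (basis P) (lie_prod ts) \<in> (lie_span (mset Q) (Suc m) :: 'f comp_sum set)"
    proof (cases "map support ts \<preceq> P")
      case False
      then show ?thesis
        using wedge_lie_prod_cut[OF finite_A P bracketing_in_set_compositions[OF ts(1)], where 'f = 'f]
        by (simp add: cs.subspace_0[OF subspace_lie_span])
    next
      case True
      then obtain us where us: "mset us = mset ts"
        and fixed: "wedge (basis P) (lie_prod us) = (lie_prod us :: 'f comp_sum)"
        using exists_sorted_permutation[OF ts(1) P, where 'f = 'f] by blast
      have us': "mset (concat (map letters us)) = mset Q" "length us < Suc m"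
        using mset_concat_letters[OF us] mset_eq_length[OF us] ts by auto
      have "lie_prod ts - lie_prod us \<in> (lie_span (mset Q) m :: 'f comp_sum set)"
        using lie_prod_permute[OF us[symmetric]] ts lie_span_mono[of "length ts" m "mset Q"] by auto
      then have "wedge (basis P) (lie_prod ts - lie_prod us) \<in> (lie_span (mset Q) (Suc m) :: 'f comp_sum set)"
        using Suc.IH lie_span_mono[of m "Suc m" "mset Q"] by auto
      then have "lie_prod us + wedge (basis P) (lie_prod ts - lie_prod us) \<in> (lie_span (mset Q) (Suc m) :: 'f comp_sum set)"
        using us' by (intro cs.subspace_add[OF subspace_lie_span] lie_prod_in_lie_span)
      then show ?thesis
        by (simp add: wedge_diff_right fixed)
    qed
  qed
qed

lemma left_ideal_lie_span: "left_ideal A (lie_span (mset Q) m)"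
proof -
  have "lie_span (mset Q) m \<subseteq> {x :: 'a comp_sum. Poly_Mapping.keys x \<subseteq> set_compositions A}"
    unfolding lie_span_def
  proof (rule cs.span_minimal[OF _ subspace_keys], clarify)
    fix ts R
    assume ts: "mset (concat (map letters ts)) = mset Q" and R: "R \<in> Poly_Mapping.keys (lie_prod ts :: 'a comp_sum)"
    have "(\<Union>t\<in>set ts. support t) = A"
      using set_compositionsD(2)[OF supports_composition[OF ts]] by auto
    then show "R \<in> set_compositions A"
      using set_mp[OF keys_lie_prod R] by simp
  qed
  then show ?thesis
    by (simp add: left_ideal_def subspace_lie_span wedge_in_lie_span)
qed

text \<open>
  A product with fewer than \<open>\<ell>(Q)\<close> factors contains a proper bracket, so it is \<open>\<dots>xy\<dots> - \<dots>yx\<dots>\<close>. Both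
  terms come from the first one under set compositions with the same blocks: the composition \<open>P\<close> of its
  supports fixes it, and the rearrangement \<open>P'\<close> turns it into the second one, because \<open>P'\<close> has too many
  blocks not to kill the difference.
\<close>

lemma lie_prod_as_difference:
  assumes ts: "mset (concat (map letters ts)) = mset Q" and "length ts < length Q"
  obtains us P P' where "mset (concat (map letters us)) = mset Q" and "length us = Suc (length ts)"
    and "P \<in> set_compositions A" and "P' \<in> set_compositions A" and "set P = set P'"
    and "lie_prod ts = wedge (basis P) (lie_prod us) - (wedge (basis P') (lie_prod us) :: 'f::field comp_sum)"
proof -
  have "\<exists>as s t bs. ts = as @ Bracket s t # bs"
  proof (rule ccontr)
    assume no: "\<nexists>as s t bs. ts = as @ Bracket s t # bs"
    have "length (letters t) = 1" if t: "t \<in> set ts" for t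
    proof -
      obtain as bs where "ts = as @ t # bs" using t by (meson split_list)
      then show ?thesis using no by (cases t) auto
    qed
    then have "length (concat (map letters ts)) = length ts"
      by (induction ts) auto
    then show False
      using assms(2) mset_eq_length[OF ts] by simp
  qed
  then obtain as s t bs where split: "ts = as @ Bracket s t # bs" by blast
  define us where "us = as @ s # t # bs"
  define vs where "vs = as @ t # s # bs"
  have us: "mset (concat (map letters us)) = mset Q" and vs: "mset (concat (map letters vs)) = mset Q"
    using ts by (simp_all add: split us_def vs_def ac_simps)
  let ?P = "map support us" and ?P' = "map support vs"
  have len: "length us = Suc (length ts)" "length vs = Suc (length ts)"
    by (simp_all add: split us_def vs_def)
  have diff: "lie_prod ts = lie_prod us - (lie_prod vs :: 'f comp_sum)"
    by (simp add: split us_def vs_def lie_prod_bracket)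
  have "(lie_prod ts :: 'f comp_sum) \<in> lie_span (mset Q) (Suc (length ts))"
    using ts by (intro lie_prod_in_lie_span) auto
  then have "wedge (basis ?P') (lie_prod ts :: 'f comp_sum) = 0"
    by (rule wedge_lie_span_long[OF supports_composition[OF vs], rotated]) (simp add: len)
  then have "wedge (basis ?P') (lie_prod us) = (lie_prod vs :: 'f comp_sum)"
    using wedge_supports_lie_prod[OF bracketing_in_set_compositions[OF vs]]
    by (simp add: diff wedge_diff_right)
  moreover have "wedge (basis ?P) (lie_prod us) = (lie_prod us :: 'f comp_sum)"
    by (rule wedge_supports_lie_prod[OF bracketing_in_set_compositions[OF us]])
  moreover have "set ?P = set ?P'"
    by (auto simp: us_def vs_def)
  ultimately show thesis
    using that[OF us len(1) supports_composition[OF us] supports_composition[OF vs]] diff by simp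
qed

lemma letters_bracketing [simp]: "concat (map letters (map Letter R)) = R"
  by (induction R) auto

lemma e_comp_in_lie_span: "e_comp Q \<in> lie_span (mset Q) (Suc (length Q))"
  unfolding e_comp_lie_prod by (rule lie_prod_in_lie_span) (simp_all del: map_map)

text \<open>
  A product of brackets reduces to products of single letters by \<open>lie_prod_as_difference\<close>, and these are
  obtained from \<open>e\<^sub>Q\<close> by acting with their own composition \<open>R\<close>, which kills the difference between \<open>e\<^sub>Q\<close>
  and \<open>e\<^sub>R\<close>.
\<close>

lemma carrier_Lambda:
  "carrier (Lambda A Q :: ('f::field comp_sum, 'f comp_sum) module) = lie_span (mset Q) (Suc (length Q))"
    (is "?L = ?D")
proof
  have L: "?L = (\<lambda>x. wedge x (e_comp Q)) ` {x. Poly_Mapping.keys x \<subseteq> set_compositions A}"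
    by (simp add: Lambda_def comp_algebra_def)
  show "?L \<subseteq> ?D"
  proof
    fix y assume "y \<in> ?L"
    then obtain x where y: "y = wedge x (e_comp Q)" and x: "Poly_Mapping.keys x \<subseteq> set_compositions A"
      unfolding L by blast
    show "y \<in> ?D"
      unfolding y
      by (rule lin_image_subspace[OF lin_wedge_left subspace_lie_span])
         (use x in \<open>blast intro: wedge_in_lie_span e_comp_in_lie_span\<close>)
  qed
  have "Poly_Mapping.keys (e_comp Q :: 'f comp_sum) \<subseteq> set_compositions A"
    using left_ideal_lie_span[of "Suc (length Q)", where 'a = 'f] e_comp_in_lie_span[where 'a = 'f]
    by (auto simp: left_ideal_def)
  then have "left_ideal A ?L"
    unfolding L carrier_comp_algebra[symmetric] by (rule left_ideal_image[OF left_ideal_algebra])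
  then have subspace: "cs.subspace ?L"
    and closed: "\<And>P x. P \<in> set_compositions A \<Longrightarrow> x \<in> ?L \<Longrightarrow> wedge (basis P) x \<in> ?L"
    by (auto simp: left_ideal_def)
  have gen: "(lie_prod ts :: 'f comp_sum) \<in> ?L" if "mset (concat (map letters ts)) = mset Q" for ts
    using that
  proof (induction "length Q - length ts" arbitrary: ts)
    case 0
    then have len: "length ts = length Q"
      using length_bracketing_le[of ts] by simp
    have letter: "\<exists>B. t = Letter B" if t: "t \<in> set ts" for t
    proof (cases t)
      case (Bracket s u)
      obtain as bs where "ts = as @ t # bs" using t by (meson split_list)
      then have "mset (concat (map letters (as @ s # u # bs))) = mset Q"
        using 0 Bracket by simp
      from length_bracketing_le[OF this] show ?thesis
        using len \<open>ts = as @ t # bs\<close> by simp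
    qed simp
    have "map (\<lambda>t. Letter (hd (letters t))) ts = ts"
      by (rule map_idI) (use letter in force)
    then have "ts = map Letter (map (\<lambda>t. hd (letters t)) ts)"
      by (simp add: comp_def)
    then obtain R where R: "ts = map Letter R" ..
    then have R': "R \<in> set_compositions A" "mset R = mset Q"
      using bracketing_in_set_compositions[OF 0(2)] 0(2) by (simp_all del: map_map)
    have "lie_prod ts - e_comp Q \<in> (lie_span (mset Q) (length ts) :: 'f comp_sum set)"
      using lie_prod_permute[of ts "map Letter Q"] R'(2)
      by (simp add: e_comp_lie_prod R del: map_map)
    then have "wedge (basis R) (lie_prod ts - e_comp Q :: 'f comp_sum) = 0"
      by (rule wedge_lie_span_long[OF R'(1), rotated]) (simp add: R)
    then have "wedge (basis R) (lie_prod ts) = wedge (basis R) (e_comp Q :: 'f comp_sum)"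
      by (simp add: wedge_diff_right)
    moreover have "wedge (basis R) (lie_prod ts) = (lie_prod ts :: 'f comp_sum)"
      using wedge_supports_lie_prod[OF bracketing_in_set_compositions[OF 0(2)]] by (simp add: R comp_def)
    ultimately show ?case
      unfolding L using R'(1) by (intro image_eqI[of _ _ "basis R"]) simp_all
  next
    case (Suc d)
    then have "length ts < length Q" by simp
    then obtain us P P' where us: "mset (concat (map letters us)) = mset Q" "length us = Suc (length ts)"
      and P: "P \<in> set_compositions A" "P' \<in> set_compositions A"
      and eq: "lie_prod ts = wedge (basis P) (lie_prod us) - (wedge (basis P') (lie_prod us) :: 'f comp_sum)"
      using lie_prod_as_difference[OF Suc.prems] by metis
    have "(lie_prod us :: 'f comp_sum) \<in> ?L"
      using Suc.hyps us by simp
    then show ?case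
      unfolding eq using P by (intro cs.subspace_diff[OF subspace] closed)
  qed
  show "?D \<subseteq> ?L"
    unfolding lie_span_def by (rule cs.span_minimal[OF _ subspace]) (use gen in blast)
qed

text \<open>
  Subtracting \<open>U \<and> x\<close> for all increasing \<open>U\<close> of length \<open>j\<close> maps every product with at most \<open>j\<close> factors
  into the span of products with fewer than \<open>j\<close>. With exactly \<open>j\<close> factors, just one \<open>U\<close> does not kill the
  product, namely that formed by the supports in increasing order of their minima, and the result is a
  rearrangement of the product.
\<close>

lemma lie_span_descend:
  assumes x: "x \<in> lie_span (mset Q) (Suc j)"
    and zero: "\<And>U. U \<in> increasing_set_compositions A \<Longrightarrow> length U = j \<Longrightarrow> wedge (basis U) x = 0"
  shows "x \<in> (lie_span (mset Q) j :: 'f::field comp_sum set)"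
proof -
  let ?I = "{U \<in> increasing_set_compositions A. length U = j}"
  define f :: "'f comp_sum \<Rightarrow> 'f comp_sum" where "f x = x - (\<Sum>U\<in>?I. wedge (basis U) x)" for x
  have fin: "finite ?I"
    by (rule finite_subset[OF _ finite_set_compositions[OF finite_A]])
       (auto simp: increasing_set_compositions_def)
  have "lin f"
    by (rule linI)
       (simp_all add: f_def wedge_add_right wedge_scl_right sum.distrib cs.scale_right_diff_distrib
          cs.scale_sum_right)
  then have "f x \<in> lie_span (mset Q) j"
  proof (rule lin_lie_span[OF _ subspace_lie_span x])
    fix ts assume ts: "mset (concat (map letters ts)) = mset Q" "length ts < Suc j"
    show "f (lie_prod ts) \<in> lie_span (mset Q) j"
    proof (cases "length ts < j")
      case True
      then have *: "lie_prod ts \<in> (lie_span (mset Q) j :: 'f comp_sum set)"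
        using ts by (intro lie_prod_in_lie_span)
      then have "wedge (basis U) (lie_prod ts :: 'f comp_sum) = 0" if "U \<in> ?I" for U
        using that by (intro wedge_lie_span_long[of U j]) (auto simp: increasing_set_compositions_def)
      then show ?thesis
        using * by (simp add: f_def)
    next
      case False
      with ts have len: "length ts = j" by simp
      define us where "us = sort_key (\<lambda>t. Min (support t)) ts"
      have us: "mset us = mset ts" by (simp add: us_def)
      then have us': "mset (concat (map letters us)) = mset Q"
        using mset_concat_letters ts(1) by metis
      let ?U = "map support us"
      have U: "?U \<in> set_compositions A" by (rule supports_composition[OF us'])
      note D = set_compositionsD[OF U]
      have "distinct (map Min ?U)"
        using Min_inj_on_blocks[OF finite_A U] D(1) by (simp only: distinct_map)
      moreover have "sorted (map Min ?U)"
        using sorted_sort_key[of "\<lambda>t. Min (support t)" ts] by (simp add: us_def comp_def)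
      ultimately have "sorted_wrt (<) (map Min ?U)"
        by (simp only: strict_sorted_iff)
      then have inc: "?U \<in> ?I"
        using U len mset_eq_length[OF us] by (simp add: increasing_set_compositions_def)
      have zero: "wedge (basis V) (lie_prod ts :: 'f comp_sum) = 0" if V: "V \<in> ?I" "V \<noteq> ?U" for V
      proof -
        have V': "V \<in> set_compositions A" "length V = j"
          using V by (auto simp: increasing_set_compositions_def)
        have "\<not> map support ts \<preceq> V"
        proof
          assume "map support ts \<preceq> V"
          then have "set (map support ts) = set V"
            using refines_length(2)[OF supports_composition[OF ts(1)] V'(1)] V' len by simp
          then have "set V = set ?U"
            using mset_eq_setD[OF us] by simp
          then show False
            using increasing_set_compositions_unique[OF finite_A] V inc by auto
        qed
        then show ?thesis
          by (rule wedge_lie_prod_cut[OF finite_A V'(1) bracketing_in_set_compositions[OF ts(1)]])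
      qed
      have diff: "lie_prod ts - lie_prod us \<in> (lie_span (mset Q) j :: 'f comp_sum set)"
        using lie_prod_permute[OF us[symmetric]] ts len by simp
      have "wedge (basis ?U) (lie_prod ts - lie_prod us :: 'f comp_sum) = 0"
        by (rule wedge_lie_span_long[OF U _ diff]) (use len mset_eq_length[OF us] in simp)
      then have "wedge (basis ?U) (lie_prod ts) = (lie_prod us :: 'f comp_sum)"
        using wedge_supports_lie_prod[OF bracketing_in_set_compositions[OF us']]
        by (simp add: wedge_diff_right)
      moreover have "(\<Sum>V\<in>?I. wedge (basis V) (lie_prod ts :: 'f comp_sum)) = wedge (basis ?U) (lie_prod ts)"
        by (subst sum.remove[OF fin inc]) (use zero in \<open>auto intro!: sum.neutral\<close>)
      ultimately show ?thesis
        using diff by (simp add: f_def)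
    qed
  qed
  then show ?thesis
    using zero by (simp add: f_def)
qed

end

section \<open>Left ideals as modules\<close>

definition ideal_module :: "nat set \<Rightarrow> 'f::field comp_sum set \<Rightarrow> ('f comp_sum, 'f comp_sum) module" where
  "ideal_module A C = (regular_module (comp_algebra A))\<lparr>carrier := C\<rparr>"

lemma ideal_module_simps [simp]:
  "carrier (ideal_module A C) = C" "zero (ideal_module A C) = 0" "add (ideal_module A C) = (+)"
  "smult (ideal_module A C) = wedge"
  by (simp_all add: ideal_module_def regular_module_def comp_algebra_def)

lemma unit_composition: "(if A = {} then [] else [A]) \<in> set_compositions A"
  by (simp add: Cons_in_set_compositions)

lemma wedge_unit:
  assumes "Poly_Mapping.keys x \<subseteq> set_compositions A"
  shows "wedge (basis (if A = {} then [] else [A])) x = x"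
proof (rule lin_eq_on_keys[where f = "wedge (basis (if A = {} then [] else [A]))" and g = "\<lambda>x. x",
      OF lin_wedge_right cs.linear_ident])
  fix R assume "R \<in> Poly_Mapping.keys x"
  then have R: "R \<in> set_compositions A" using assms by blast
  then have "A \<noteq> {} \<Longrightarrow> trace A R = R" "A = {} \<Longrightarrow> R = []"
    using set_compositionsD(2,3)[OF R] by (auto intro!: trace_ident)
  then show "wedge (basis (if A = {} then [] else [A])) (basis R) = basis R"
    by (auto simp: comp_wedge_Cons)
qed

lemma inv_ideal_module:
  assumes "left_ideal A C" and "x \<in> C"
  shows "m_inv (add_monoid (ideal_module A C)) x = - x"
proof -
  have "- x \<in> C"
    using assms by (auto simp: left_ideal_def intro: cs.subspace_neg)
  then show ?thesis
    unfolding m_inv_def by (intro the_equality) (auto simp: eq_neg_iff_add_eq_0 add.commute)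
qed

text \<open>
  Scalars act through the multiples of the identity, so submodules are automatically subspaces.
\<close>

lemma submodule_ideal_module_iff:
  assumes C: "left_ideal A C"
  shows "submodule K (comp_algebra A) (ideal_module A C) \<longleftrightarrow> left_ideal A K \<and> K \<subseteq> C"
proof
  assume K: "submodule K (comp_algebra A) (ideal_module A C)"
  then interpret submodule K "comp_algebra A" "ideal_module A C" .
  have sub: "K \<subseteq> C" using subset by simp
  have wedge: "wedge r x \<in> K" if "Poly_Mapping.keys r \<subseteq> set_compositions A" "x \<in> K" for r x
    using smult_closed[of r x] that by simp
  have "cs.subspace K"
  proof (rule cs.subspaceI)
    show "0 \<in> K" using one_closed by simp
    show "x + y \<in> K" if "x \<in> K" "y \<in> K" for x y using m_closed[OF that] by simp
    show "scl c x \<in> K" if x: "x \<in> K" for c x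
    proof -
      let ?u = "if A = {} then [] else [A]"
      have "Poly_Mapping.keys x \<subseteq> set_compositions A"
        using x sub C by (auto simp: left_ideal_def)
      then have "scl c x = wedge (scl c (basis ?u)) x"
        by (simp add: wedge_scl_left wedge_unit del: if_image_distrib)
      moreover have "Poly_Mapping.keys (scl c (basis ?u)) \<subseteq> set_compositions A"
        by (rule subset_trans[OF keys_scl]) (use unit_composition[of A] in simp)
      ultimately show ?thesis
        using wedge[OF _ x] by metis
    qed
  qed
  then show "left_ideal A K \<and> K \<subseteq> C"
    using sub C wedge by (auto simp: left_ideal_def)
next
  assume K: "left_ideal A K \<and> K \<subseteq> C"
  show "submodule K (comp_algebra A) (ideal_module A C)"
  proof (intro submodule.intro subgroup.intro submodule_axioms.intro)
    show "inv\<^bsub>add_monoid (ideal_module A C)\<^esub> x \<in> K" if "x \<in> K" for x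
    proof -
      from that K have "x \<in> C" by blast
      then show ?thesis
        unfolding inv_ideal_module[OF C \<open>x \<in> C\<close>]
        using that K by (auto simp: left_ideal_def intro: cs.subspace_neg)
    qed
  qed (use K in \<open>auto simp: left_ideal_def intro: cs.subspace_add cs.subspace_0 left_ideal_wedge\<close>)
qed

section \<open>The radical series\<close>

lemma rad_ideal_module:
  "rad (comp_algebra A) (ideal_module A C) =
     ideal_module A (C \<inter> \<Inter>{N. maximal_submodule N (comp_algebra A) (ideal_module A C)})"
  unfolding rad_def by (simp add: ideal_module_def)

context composition
begin

text \<open>
  By associativity \<open>U \<and> P\<close> acts, which equals \<open>U\<close> or is longer than \<open>U\<close>.
\<close>

lemma wedge_wedge_top:
  assumes U: "U \<in> set_compositions A" and P: "P \<in> set_compositions A"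
    and x: "x \<in> (lie_span (mset Q) (Suc (length U)) :: 'f::field comp_sum set)"
  shows "wedge (basis U) (wedge (basis P) x) = (if U \<preceq> P then wedge (basis U) x else 0)"
proof (cases "U \<preceq> P")
  case True
  then have "comp_wedge U P = U"
    using comp_wedge_absorb[OF P] set_compositionsD(3)[OF U] by blast
  then show ?thesis
    using True by (simp flip: wedge_assoc)
next
  case False
  then have "Suc (length U) \<le> length (comp_wedge U P)"
    using length_comp_wedge(2)[OF U P] by simp
  moreover have "comp_wedge U P \<in> set_compositions A"
    using comp_wedge_in_set_compositions[OF U P] by simp
  ultimately have "wedge (basis (comp_wedge U P)) x = 0"
    using wedge_lie_span_long x by blast
  then show ?thesis
    using False by (simp flip: wedge_assoc)
qed

lemma left_ideal_coefficient_kernel: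
  assumes U: "U \<in> set_compositions A"
  shows "left_ideal A {y \<in> lie_span (mset Q) (Suc (length U)) :: 'f::field comp_sum set.
    Poly_Mapping.lookup (wedge (basis U) y) W = 0}"
proof -
  let ?D = "lie_span (mset Q) (Suc (length U)) :: 'f comp_sum set"
  let ?K = "{y \<in> ?D. Poly_Mapping.lookup (wedge (basis U) y) W = 0}"
  have "cs.subspace ?K"
    by (rule cs.subspaceI)
       (auto simp: wedge_add_right wedge_scl_right lookup_add
          intro: cs.subspace_0[OF subspace_lie_span] cs.subspace_add[OF subspace_lie_span]
            cs.subspace_scale[OF subspace_lie_span])
  moreover have "wedge (basis P) y \<in> ?K" if "P \<in> set_compositions A" "y \<in> ?K" for P y
    using that wedge_wedge_top[OF U that(1), of y] by (auto intro: wedge_in_lie_span)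
  ultimately show ?thesis
    using left_ideal_lie_span[of "Suc (length U)", where 'a = 'f] unfolding left_ideal_def by blast
qed

text \<open>
  The kernel of a non-zero linear functional has codimension one.
\<close>

lemma maximal_coefficient_kernel:
  assumes U: "U \<in> set_compositions A"
    and ne: "{y \<in> lie_span (mset Q) (Suc (length U)). Poly_Mapping.lookup (wedge (basis U) y) W = 0}
      \<noteq> (lie_span (mset Q) (Suc (length U)) :: 'f::field comp_sum set)"
  shows "maximal_submodule {y \<in> lie_span (mset Q) (Suc (length U)). Poly_Mapping.lookup (wedge (basis U) y) W = 0}
    (comp_algebra A) (ideal_module A (lie_span (mset Q) (Suc (length U)) :: 'f comp_sum set))"
proof -
  let ?D = "lie_span (mset Q) (Suc (length U)) :: 'f comp_sum set"
  let ?K = "{y \<in> ?D. Poly_Mapping.lookup (wedge (basis U) y) W = 0}"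
  have "L = ?D" if L: "left_ideal A L" "L \<subseteq> ?D" "?K \<subseteq> L" "L \<noteq> ?K" for L
  proof
    show "?D \<subseteq> L"
    proof
      fix y assume y: "y \<in> ?D"
      let ?c = "\<lambda>y. Poly_Mapping.lookup (wedge (basis U) y) W"
      from L obtain z where z: "z \<in> L" "z \<notin> ?K" by blast
      then have zD: "z \<in> ?D" "?c z \<noteq> 0" using L(2) by auto
      let ?s = "scl (?c y / ?c z) z"
      have "y - ?s \<in> ?K"
        using y zD by (auto simp: wedge_diff_right wedge_scl_right lookup_minus
            intro!: cs.subspace_diff[OF subspace_lie_span] cs.subspace_scale[OF subspace_lie_span])
      moreover have "?s \<in> L"
        using L(1) z by (auto simp: left_ideal_def intro: cs.subspace_scale)
      ultimately have "(y - ?s) + ?s \<in> L"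
        using L(1,3) unfolding left_ideal_def by (blast intro: cs.subspace_add)
      then show "y \<in> L" by simp
    qed
  qed (fact L(2))
  then show ?thesis
    using left_ideal_coefficient_kernel[OF U] ne
    unfolding maximal_submodule_def submodule_ideal_module_iff[OF left_ideal_lie_span] by fastforce
qed

text \<open>
  Write \<open>D\<^sub>i\<close> for the span of products with fewer than \<open>i\<close> factors. If \<open>N\<close> does not contain \<open>D\<^sub>j\<close>, then
  \<open>D\<^bsub>j+1\<^esub> = N + D\<^sub>j\<close> by maximality. Descending induction improves this to \<open>D\<^bsub>j+1\<^esub> = N + D\<^sub>i\<close> for all
  \<open>i \<le> j\<close>: elements of \<open>D\<^bsub>i+1\<^esub>\<close> are combinations of elements \<open>(P - P') \<and> (a + b)\<close> with \<open>a \<in> N\<close> and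
  \<open>b \<in> D\<^bsub>i+1\<^esub>\<close>, modulo \<open>D\<^sub>i\<close>, and \<open>(P - P') \<and> b\<close> lies in \<open>D\<^sub>i\<close>. For \<open>i = 0\<close> this contradicts that \<open>N\<close> is
  proper.
\<close>

lemma lie_span_le_maximal:
  assumes j: "j \<le> length Q"
    and N: "maximal_submodule N (comp_algebra A) (ideal_module A (lie_span (mset Q) (Suc j)))"
  shows "lie_span (mset Q) j \<subseteq> (N :: 'f::field comp_sum set)"
proof (rule ccontr)
  let ?D = "\<lambda>m. lie_span (mset Q) m :: 'f comp_sum set"
  assume not: "\<not> ?D j \<subseteq> N"
  from N have NI: "left_ideal A N" and ND: "N \<subseteq> ?D (Suc j)" "N \<noteq> ?D (Suc j)"
    and max: "\<And>K. left_ideal A K \<Longrightarrow> K \<subseteq> ?D (Suc j) \<Longrightarrow> N \<subseteq> K \<Longrightarrow> K = N \<or> K = ?D (Suc j)"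
    unfolding maximal_submodule_def submodule_ideal_module_iff[OF left_ideal_lie_span] by auto
  have N_sub: "cs.subspace N" and N_closed: "\<And>P x. P \<in> set_compositions A \<Longrightarrow> x \<in> N \<Longrightarrow> wedge (basis P) x \<in> N"
    using NI by (auto simp: left_ideal_def)
  let ?S = "\<lambda>i. {x + y | x y. x \<in> N \<and> y \<in> ?D i}"
  have S_sub: "cs.subspace (?S i)" for i
    by (rule cs.subspace_sums[OF N_sub subspace_lie_span])
  have N_S: "x \<in> ?S i" if "x \<in> N" for x i
    using that cs.subspace_0[OF subspace_lie_span, of "mset Q" i] by force
  have D_S: "x \<in> ?S i" if "x \<in> ?D i" for x i
    using that cs.subspace_0[OF N_sub] by force
  have "?D (Suc j) \<subseteq> ?S 0"
    using le0[of j]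
  proof (induction rule: inc_induct)
    case base
    have "?S j \<subseteq> ?D (Suc j)"
    proof clarify
      fix x y assume "x \<in> N" "y \<in> ?D j"
      then show "x + y \<in> ?D (Suc j)"
        using ND(1) lie_span_mono[of j "Suc j" "mset Q"]
        by (intro cs.subspace_add[OF subspace_lie_span]) auto
    qed
    moreover have "N \<subseteq> ?S j" using N_S by blast
    moreover have "?S j \<noteq> N" using not D_S by blast
    ultimately show ?case
      using max[OF left_ideal_sum[OF NI left_ideal_lie_span]] by blast
  next
    case (step i)
    have "?D (Suc i) \<subseteq> ?S i"
    proof
      fix x assume "x \<in> ?D (Suc i)"
      then show "x \<in> ?S i"
      proof (rule lin_lie_span[OF cs.linear_ident S_sub])
        fix ts assume ts: "mset (concat (map letters ts)) = mset Q" "length ts < Suc i"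
        show "lie_prod ts \<in> ?S i"
        proof (cases "length ts < i")
          case True
          then show ?thesis
            using ts by (intro D_S lie_prod_in_lie_span)
        next
          case False
          then have len: "length ts = i" using ts by simp
          then have "length ts < length Q" using step.hyps j by simp
          then obtain us P P' where us: "mset (concat (map letters us)) = mset Q" "length us = Suc (length ts)"
            and P: "P \<in> set_compositions A" "P' \<in> set_compositions A" "set P = set P'"
            and eq: "lie_prod ts = wedge (basis P) (lie_prod us) - (wedge (basis P') (lie_prod us) :: 'f comp_sum)"
            using lie_prod_as_difference[OF ts(1)] by metis
          have "(lie_prod us :: 'f comp_sum) \<in> ?D (Suc j)"
            using us len step.hyps by (intro lie_prod_in_lie_span) auto
          then obtain a b where ab: "lie_prod us = a + b" "a \<in> N" "b \<in> ?D (Suc i)"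
            using step.IH by blast
          have "wedge (basis P) b - wedge (basis P') b \<in> ?D i"
          proof (rule lie_span_descend)
            show "wedge (basis P) b - wedge (basis P') b \<in> ?D (Suc i)"
              using ab(3) P by (intro cs.subspace_diff[OF subspace_lie_span] wedge_in_lie_span)
            fix U assume "U \<in> increasing_set_compositions A" "length U = i"
            then have U: "U \<in> set_compositions A" "b \<in> ?D (Suc (length U))"
              using ab(3) by (auto simp: increasing_set_compositions_def)
            have "U \<preceq> P \<longleftrightarrow> U \<preceq> P'"
              by (simp add: refines_def P(3))
            then show "wedge (basis U) (wedge (basis P) b - wedge (basis P') b) = 0"
              by (simp add: wedge_diff_right wedge_wedge_top[OF U(1) P(1) U(2)] wedge_wedge_top[OF U(1) P(2) U(2)])
          qed
          moreover have "wedge (basis P) a - wedge (basis P') a \<in> N"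
            using ab(2) P by (intro cs.subspace_diff[OF N_sub] N_closed)
          moreover have "lie_prod ts = (wedge (basis P) a - wedge (basis P') a)
              + (wedge (basis P) b - wedge (basis P') b)"
            by (simp add: eq ab(1) wedge_add_right)
          ultimately show ?thesis by blast
        qed
      qed
    qed
    have "?S (Suc i) \<subseteq> ?S i"
    proof clarify
      fix x y assume "x \<in> N" "y \<in> ?D (Suc i)"
      then have "x + y \<in> ?S i"
        using \<open>?D (Suc i) \<subseteq> ?S i\<close> by (intro cs.subspace_add[OF S_sub N_S]) auto
      then show "\<exists>x' y'. x + y = x' + y' \<and> x' \<in> N \<and> y' \<in> ?D i" by blast
    qed
    then show ?case using step.IH by blast
  qed
  moreover have "?D 0 = {0}"
    by (simp add: lie_span_def)
  ultimately have "?D (Suc j) \<subseteq> N" by auto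
  then show False using ND by blast
qed

text \<open>
  Truncated subtraction is harmless: for \<open>j = 0\<close> both sides are the zero module.
\<close>

lemma rad_lie_span:
  assumes "j \<le> Suc (length Q)"
  shows "rad (comp_algebra A) (ideal_module A (lie_span (mset Q) j))
    = ideal_module A (lie_span (mset Q) (j - 1) :: 'f::field comp_sum set)"
proof -
  let ?D = "\<lambda>m. lie_span (mset Q) m :: 'f comp_sum set"
  let ?max = "\<lambda>N. maximal_submodule N (comp_algebra A) (ideal_module A (?D j))"
  have "?D j \<inter> \<Inter>{N. ?max N} = ?D (j - 1)"
  proof (cases j)
    case 0
    have "0 \<in> N" if "?max N" for N
      using that cs.subspace_0[of N]
      unfolding maximal_submodule_def submodule_ideal_module_iff[OF left_ideal_lie_span] left_ideal_def
      by blast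
    moreover have "?D 0 = {0}" by (simp add: lie_span_def)
    ultimately show ?thesis using 0 by auto
  next
    case (Suc i)
    show ?thesis
    proof
      show "?D (j - 1) \<subseteq> ?D j \<inter> \<Inter>{N. ?max N}"
        using lie_span_le_maximal[of i] lie_span_mono[of i j "mset Q"] assms Suc by auto
      show "?D j \<inter> \<Inter>{N. ?max N} \<subseteq> ?D (j - 1)"
      proof
        fix x assume x: "x \<in> ?D j \<inter> \<Inter>{N. ?max N}"
        have "x \<in> ?D i"
        proof (rule lie_span_descend)
          show "x \<in> ?D (Suc i)" using x Suc by simp
          fix U assume "U \<in> increasing_set_compositions A" and len: "length U = i"
          then have U: "U \<in> set_compositions A" by (simp add: increasing_set_compositions_def)
          show "wedge (basis U) x = 0"
          proof (rule poly_mapping_eqI)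
            fix W
            let ?K = "{y \<in> ?D (Suc (length U)). Poly_Mapping.lookup (wedge (basis U) y) W = 0}"
            have "x \<in> ?K"
              using maximal_coefficient_kernel[OF U, of W] x Suc len by (cases "?K = ?D j") auto
            then show "Poly_Mapping.lookup (wedge (basis U) x) W = Poly_Mapping.lookup 0 W"
              by simp
          qed
        qed
        then show "x \<in> ?D (j - 1)" using Suc by simp
      qed
    qed
  qed
  then show ?thesis by (simp add: rad_ideal_module)
qed

lemma Lambda_eq_ideal_module:
  "Lambda A Q = ideal_module A (lie_span (mset Q) (Suc (length Q)))"
  unfolding carrier_Lambda[symmetric] by (simp add: Lambda_def ideal_module_def)

lemma rad_power_Lambda:
  "rad_power (comp_algebra A) k (Lambda A Q) = ideal_module A (lie_span (mset Q) (Suc (length Q) - k))"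
  unfolding rad_power_def Lambda_eq_ideal_module
  by (induction k) (simp_all add: rad_lie_span)

end

section \<open>Quotients of left ideals\<close>

definition coset :: "'f::field comp_sum set \<Rightarrow> 'f comp_sum \<Rightarrow> 'f comp_sum set" where
  "coset N x = (\<lambda>h. h + x) ` N"

lemma quotient_carrier: "carrier (quotient_module (ideal_module A C) N) = coset N ` C"
  by (auto simp: quotient_module_def A_RCOSETS_def RCOSETS_def r_coset_def coset_def)

lemma quotient_zero: "zero (quotient_module M N) = N"
  by (simp add: quotient_module_def)

lemma coset_eq_iff:
  assumes N: "cs.subspace N"
  shows "coset N x = coset N y \<longleftrightarrow> x - y \<in> N"
proof
  assume "coset N x = coset N y"
  moreover have "x \<in> coset N x"
    unfolding coset_def using cs.subspace_0[OF N] by force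
  ultimately show "x - y \<in> N"
    by (auto simp: coset_def)
next
  have sub: "coset N x \<subseteq> coset N y" if "x - y \<in> N" for x y
  proof
    fix z assume "z \<in> coset N x"
    then obtain h where "h \<in> N" "z = h + x" by (auto simp: coset_def)
    then have "z = (h + (x - y)) + y" "h + (x - y) \<in> N"
      using that by (simp_all add: cs.subspace_add[OF N])
    then show "z \<in> coset N y" unfolding coset_def by blast
  qed
  assume "x - y \<in> N"
  moreover from this have "y - x \<in> N"
    using cs.subspace_neg[OF N, of "x - y"] by simp
  ultimately show "coset N x = coset N y"
    using sub by blast
qed

lemma coset_zero: "coset N 0 = N"
  by (simp add: coset_def)

lemma coset_eq_self_iff: "cs.subspace N \<Longrightarrow> coset N x = N \<longleftrightarrow> x \<in> N"
  using coset_eq_iff[of N x 0] by (simp add: coset_zero)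

lemma quotient_add:
  assumes N: "cs.subspace N"
  shows "add (quotient_module (ideal_module A C) N) (coset N x) (coset N y) = coset N (x + y)"
proof -
  have "add (quotient_module (ideal_module A C) N) (coset N x) (coset N y)
      = {a + b | a b. a \<in> coset N x \<and> b \<in> coset N y}"
    by (auto simp: quotient_module_def set_add_def set_mult_def)
  also have "\<dots> = coset N (x + y)"
  proof
    show "{a + b | a b. a \<in> coset N x \<and> b \<in> coset N y} \<subseteq> coset N (x + y)"
    proof clarify
      fix a b assume "a \<in> coset N x" "b \<in> coset N y"
      then obtain h k where "h \<in> N" "k \<in> N" "a = h + x" "b = k + y" by (auto simp: coset_def)
      then have "a + b = (h + k) + (x + y)" "h + k \<in> N"
        by (simp_all add: cs.subspace_add[OF N] algebra_simps)
      then show "a + b \<in> coset N (x + y)" unfolding coset_def by blast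
    qed
    show "coset N (x + y) \<subseteq> {a + b | a b. a \<in> coset N x \<and> b \<in> coset N y}"
    proof
      fix z assume "z \<in> coset N (x + y)"
      then obtain h where "h \<in> N" "z = (h + x) + (0 + y)" by (auto simp: coset_def algebra_simps)
      then show "z \<in> {a + b | a b. a \<in> coset N x \<and> b \<in> coset N y}"
        unfolding coset_def using cs.subspace_0[OF N] by blast
    qed
  qed
  finally show ?thesis .
qed

lemma quotient_smult:
  assumes N: "left_ideal A N" and r: "Poly_Mapping.keys r \<subseteq> set_compositions A"
  shows "smult (quotient_module (ideal_module A C) N) r (coset N x) = coset N (wedge r x)"
proof -
  have sub: "cs.subspace N" using N by (simp add: left_ideal_def)
  have "smult (quotient_module (ideal_module A C) N) r (coset N x) = (\<Union>h\<in>N. coset N (wedge r (h + x)))"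
    by (auto simp: quotient_module_def a_r_coset_def r_coset_def coset_def)
  also have "\<dots> = (\<Union>h\<in>N. coset N (wedge r x))"
  proof (rule SUP_cong[OF refl])
    fix h assume "h \<in> N"
    then have "wedge r h \<in> N" by (rule left_ideal_wedge[OF N r])
    then show "coset N (wedge r (h + x)) = coset N (wedge r x)"
      by (simp add: coset_eq_iff[OF sub] wedge_add_right)
  qed
  also have "\<dots> = coset N (wedge r x)"
    using cs.subspace_0[OF sub] by auto
  finally show ?thesis .
qed

lemma submodule_quotient:
  assumes N: "left_ideal A N" and K: "left_ideal A K" and KC: "K \<subseteq> C"
  shows "submodule (coset N ` K) (comp_algebra A) (quotient_module (ideal_module A C) N)"
proof -
  have Ns: "cs.subspace N" and Ks: "cs.subspace K"
    using N K by (simp_all add: left_ideal_def)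
  let ?M = "quotient_module (ideal_module A C) N"
  show ?thesis
  proof (intro submodule.intro subgroup.intro submodule_axioms.intro)
    show "coset N ` K \<subseteq> carrier (add_monoid ?M)"
      using KC by (auto simp: quotient_carrier)
    show "x \<otimes>\<^bsub>add_monoid ?M\<^esub> y \<in> coset N ` K" if "x \<in> coset N ` K" "y \<in> coset N ` K" for x y
      using that by (auto simp: quotient_add[OF Ns] intro: cs.subspace_add[OF Ks])
    show "\<one>\<^bsub>add_monoid ?M\<^esub> \<in> coset N ` K"
      using image_eqI[OF _ cs.subspace_0[OF Ks], of N "coset N"] by (simp add: quotient_zero coset_zero)
    show "r \<odot>\<^bsub>?M\<^esub> x \<in> coset N ` K" if "r \<in> carrier (comp_algebra A)" "x \<in> coset N ` K" for r x
      using that by (auto simp: quotient_smult[OF N] intro: left_ideal_wedge[OF K])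
    show "inv\<^bsub>add_monoid ?M\<^esub> X \<in> coset N ` K" if X: "X \<in> coset N ` K" for X
    proof -
      from X obtain x where x: "x \<in> K" "X = coset N x" by blast
      then have neg: "- x \<in> K" using cs.subspace_neg[OF Ks] by blast
      have "inv\<^bsub>add_monoid ?M\<^esub> X = coset N (- x)"
        unfolding m_inv_def
      proof (rule the_equality)
        show "coset N (- x) \<in> carrier (add_monoid ?M)
            \<and> X \<otimes>\<^bsub>add_monoid ?M\<^esub> coset N (- x) = \<one>\<^bsub>add_monoid ?M\<^esub>
            \<and> coset N (- x) \<otimes>\<^bsub>add_monoid ?M\<^esub> X = \<one>\<^bsub>add_monoid ?M\<^esub>"
          using neg KC by (auto simp: quotient_carrier quotient_add[OF Ns] quotient_zero x coset_zero)
        fix Y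
        assume "Y \<in> carrier (add_monoid ?M) \<and> X \<otimes>\<^bsub>add_monoid ?M\<^esub> Y = \<one>\<^bsub>add_monoid ?M\<^esub>
            \<and> Y \<otimes>\<^bsub>add_monoid ?M\<^esub> X = \<one>\<^bsub>add_monoid ?M\<^esub>"
        then obtain y where "Y = coset N y" "coset N (x + y) = N"
          by (auto simp: quotient_carrier quotient_add[OF Ns] quotient_zero x)
        then show "Y = coset N (- x)"
          by (simp add: coset_eq_iff[OF Ns] coset_eq_self_iff[OF Ns] add.commute)
      qed
      then show ?thesis using neg by blast
    qed
  qed
qed

text \<open>
  Right multiplication commutes with the left action. The union over a coset only serves to define the
  map without choosing representatives, since all elements of a coset have the same image.
\<close>

lemma right_multiplication_quotient_iso:
  assumes C: "left_ideal A C" and N: "left_ideal A N" and N': "left_ideal A N'"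
    and kernel: "\<And>x. x \<in> C \<Longrightarrow> wedge x w \<in> N' \<longleftrightarrow> x \<in> N" and NC: "N \<subseteq> C"
  shows "(\<lambda>X. \<Union>x\<in>X. coset N' (wedge x w)) \<in> module_iso (comp_algebra A)
     (quotient_module (ideal_module A C) N)
     ((quotient_module (ideal_module A C') N')\<lparr>carrier := coset N' ` (\<lambda>x. wedge x w) ` C\<rparr>)"
    (is "?f \<in> module_iso _ ?M (?M'\<lparr>carrier := ?U\<rparr>)")
proof -
  have Cs: "cs.subspace C" and Ns: "cs.subspace N" and Ns': "cs.subspace N'"
    using C N N' by (simp_all add: left_ideal_def)
  have f: "?f (coset N x) = coset N' (wedge x w)" if "x \<in> C" for x
  proof -
    have "?f (coset N x) = (\<Union>h\<in>N. coset N' (wedge (h + x) w))"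
      by (simp add: coset_def)
    also have "\<dots> = (\<Union>h\<in>N. coset N' (wedge x w))"
      by (intro SUP_cong[OF refl])
         (use kernel NC in \<open>auto simp: coset_eq_iff[OF Ns'] wedge_add_left\<close>)
    also have "\<dots> = coset N' (wedge x w)"
      using cs.subspace_0[OF Ns] by auto
    finally show ?thesis .
  qed
  have "?f \<in> hom (add_monoid ?M) (add_monoid (?M'\<lparr>carrier := ?U\<rparr>))"
  proof (rule homI)
    fix X Y assume "X \<in> carrier (add_monoid ?M)" "Y \<in> carrier (add_monoid ?M)"
    then obtain x y where xy: "X = coset N x" "Y = coset N y" "x \<in> C" "y \<in> C"
      by (auto simp: quotient_carrier)
    show "?f X \<in> carrier (add_monoid (?M'\<lparr>carrier := ?U\<rparr>))"
      unfolding xy f[OF xy(3)] using xy(3) by simp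
    have "?f (coset N (x + y)) = coset N' (wedge (x + y) w)"
      using xy by (intro f cs.subspace_add[OF Cs])
    then show "?f (X \<otimes>\<^bsub>add_monoid ?M\<^esub> Y) = ?f X \<otimes>\<^bsub>add_monoid (?M'\<lparr>carrier := ?U\<rparr>)\<^esub> ?f Y"
      unfolding xy f[OF xy(3)] f[OF xy(4)]
      by (simp add: quotient_add[OF Ns] quotient_add[OF Ns'] wedge_add_left del: UN_simps)
  qed
  moreover have "bij_betw ?f (carrier (add_monoid ?M)) (carrier (add_monoid (?M'\<lparr>carrier := ?U\<rparr>)))"
    unfolding bij_betw_def
  proof
    show "inj_on ?f (carrier (add_monoid ?M))"
    proof (rule inj_onI)
      fix X Y assume "X \<in> carrier (add_monoid ?M)" "Y \<in> carrier (add_monoid ?M)" and eq: "?f X = ?f Y"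
      then obtain x y where xy: "X = coset N x" "Y = coset N y" "x \<in> C" "y \<in> C"
        by (auto simp: quotient_carrier)
      have "wedge (x - y) w \<in> N'"
        using eq unfolding xy f[OF xy(3)] f[OF xy(4)] coset_eq_iff[OF Ns'] wedge_diff_left .
      then show "X = Y"
        using kernel[of "x - y"] xy by (simp add: coset_eq_iff[OF Ns] cs.subspace_diff[OF Cs])
    qed
    have "?f ` (coset N ` C) = ?U"
      unfolding image_image using f by (intro image_cong) auto
    then show "?f ` carrier (add_monoid ?M) = carrier (add_monoid (?M'\<lparr>carrier := ?U\<rparr>))"
      by (simp add: quotient_carrier)
  qed
  moreover have "?f (r \<odot>\<^bsub>?M\<^esub> X) = r \<odot>\<^bsub>?M'\<lparr>carrier := ?U\<rparr>\<^esub> ?f X"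
    if "r \<in> carrier (comp_algebra A)" "X \<in> carrier ?M" for r X
  proof -
    from that obtain x where x: "X = coset N x" "x \<in> C" by (auto simp: quotient_carrier)
    have r: "Poly_Mapping.keys r \<subseteq> set_compositions A" using that by simp
    have "?f (coset N (wedge r x)) = coset N' (wedge (wedge r x) w)"
      by (intro f left_ideal_wedge[OF C r] x)
    then show ?thesis
      unfolding x f[OF x(2)] by (simp add: quotient_smult[OF N r] quotient_smult[OF N' r] wedge_assoc del: UN_simps)
  qed
  ultimately show ?thesis
    by (simp add: module_iso_def iso_def)
qed

section \<open>The one-dimensional modules\<close>

text \<open>
  The term \<open>T\<close> comes from the one-block term \<open>B\<close> of each \<open>e\<^sub>B\<close>; all others split some block.
\<close>

lemma keys_e_comp:
  assumes "T \<in> set_compositions A" and "R \<in> Poly_Mapping.keys (e_comp T :: 'f::field comp_sum)"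
  shows "R = T \<or> length T < length R"
  using assms
proof (induction T arbitrary: A R)
  case Nil
  then show ?case by (simp add: e_comp_def)
next
  case (Cons p T)
  from Cons.prems(2) obtain X Y where R: "R = X @ Y" "X \<in> Poly_Mapping.keys (e_block p :: 'f comp_sum)"
    "Y \<in> Poly_Mapping.keys (e_comp T :: 'f comp_sum)"
    using keys_vee[of "e_block p :: 'f comp_sum" "e_comp T"] by (auto simp: e_comp_def)
  have X: "X \<in> set_compositions p" using keys_e_block R(2) by blast
  have "p \<noteq> {}" using Cons.prems(1) by (simp add: Cons_in_set_compositions)
  then obtain x X' where X': "X = x # X'" using X by (cases X) auto
  have "X' = [] \<Longrightarrow> X = [p]"
    using set_compositionsD(2)[OF X] X' by simp
  then have "X = [p] \<or> 2 \<le> length X"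
    using X' by (cases X') auto
  moreover have "Y = T \<or> length T < length Y"
    using Cons.IH[of "A - p" Y] Cons.prems(1) R(3) by (simp add: Cons_in_set_compositions)
  ultimately show ?case
    using R(1) by auto
qed

context composition
begin

lemma e_comp_bracketing: "mset (concat (map letters (map Letter Q))) = mset Q"
  by (simp del: map_map)

lemma supports_Letter: "map support (map Letter Q) = Q"
  by (simp add: comp_def)

lemma wedge_lie_span_cut:
  assumes U: "U \<in> set_compositions A" and cut: "\<not> Q \<preceq> U" and x: "x \<in> lie_span (mset Q) m"
  shows "wedge (basis U) x = (0 :: 'f::field comp_sum)"
proof -
  have "wedge (basis U) x \<in> {0}"
  proof (rule lin_lie_span[OF lin_wedge_right _ x])
    fix ts assume ts: "mset (concat (map letters ts)) = mset Q"
    have "Q \<preceq> map support ts"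
      unfolding refines_def
    proof
      fix q assume "q \<in> set Q"
      then have "q \<in> set (concat (map letters ts))" using mset_eq_setD[OF ts] by simp
      then obtain t where "t \<in> set ts" "q \<in> set (letters t)" by auto
      then show "\<exists>p\<in>set (map support ts). q \<subseteq> p" by (auto simp: support_def)
    qed
    then have "\<not> map support ts \<preceq> U"
      using cut refines_trans by blast
    then show "wedge (basis U) (lie_prod ts) \<in> {0 :: 'f comp_sum}"
      using wedge_lie_prod_cut[OF finite_A U bracketing_in_set_compositions[OF ts]] by simp
  qed simp
  then show ?thesis by simp
qed

lemma wedge_Q_e_comp: "wedge (basis Q) (e_comp Q) = (e_comp Q :: 'f::field comp_sum)"
  using wedge_supports_lie_prod[OF bracketing_in_set_compositions[OF e_comp_bracketing]]
  by (simp only: supports_Letter flip: e_comp_lie_prod)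

lemma lookup_e_comp: "Poly_Mapping.lookup (e_comp Q) Q = (1 :: 'f::field)"
  using lookup_lie_prod_letters[OF bracketing_in_set_compositions[OF e_comp_bracketing] finite_A, where 'f = 'f]
  by (simp only: letters_bracketing flip: e_comp_lie_prod)

text \<open>
  This replaces the idempotent \<open>e\<^sub>Q\<close> by its leading term \<open>Q\<close>, whose action is easier to compute.
\<close>

lemma e_comp_wedge:
  assumes "\<And>P. P \<in> set_compositions A \<Longrightarrow> length Q < length P \<Longrightarrow> wedge (basis P) w = 0"
  shows "wedge (e_comp Q) w = wedge (basis Q) (w :: 'f::field comp_sum)"
proof -
  have "e_comp Q \<in> (lie_span (mset Q) (Suc (length Q)) :: 'f comp_sum set)"
    by (rule e_comp_in_lie_span)
  then have keys: "Poly_Mapping.keys (e_comp Q :: 'f comp_sum) \<subseteq> set_compositions A"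
    using left_ideal_lie_span[of "Suc (length Q)", where 'a = 'f] by (auto simp: left_ideal_def)
  have "wedge (e_comp Q - basis Q) w \<in> {0}"
  proof (rule lin_image_subspace[OF lin_wedge_left])
    fix R assume R: "R \<in> Poly_Mapping.keys (e_comp Q - basis Q :: 'f comp_sum)"
    have "R \<noteq> Q"
      using R by (auto simp: in_keys_iff lookup_minus lookup_e_comp)
    then have "R \<in> Poly_Mapping.keys (e_comp Q :: 'f comp_sum)"
      using R by (auto simp: in_keys_iff lookup_minus lookup_single)
    then show "wedge (basis R) w \<in> {0}"
      using assms[of R] keys keys_e_comp[OF Q] \<open>R \<noteq> Q\<close> by auto
  qed simp
  then show ?thesis by (simp add: wedge_diff_left)
qed

text \<open>
  The quotient of \<open>\<Lambda>\<^sub>Q\<close> by its radical is one-dimensional because \<open>Q \<and> P \<and> e\<^sub>Q\<close> is always \<open>e\<^sub>Q\<close> or \<open>0\<close>.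
\<close>

lemma wedge_Q_multiple:
  assumes x: "x \<in> lie_span (mset Q) (Suc (length Q))"
  shows "\<exists>c. wedge (basis Q) x = scl c (e_comp Q :: 'f::field comp_sum)"
proof -
  from x obtain y where y: "x = wedge y (e_comp Q)" "Poly_Mapping.keys y \<subseteq> set_compositions A"
    unfolding carrier_Lambda[symmetric] by (auto simp: Lambda_def)
  have "wedge (basis Q) (wedge y (e_comp Q)) \<in> cs.span {e_comp Q :: 'f comp_sum}"
  proof (rule lin_image_subspace[OF lin_comp[OF lin_wedge_right lin_wedge_left] cs.subspace_span])
    fix P assume "P \<in> Poly_Mapping.keys y"
    then have P: "P \<in> set_compositions A" using y by blast
    show "wedge (basis Q) (wedge (basis P) (e_comp Q)) \<in> cs.span {e_comp Q :: 'f comp_sum}"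
      using wedge_wedge_top[OF Q P e_comp_in_lie_span, where 'f = 'f]
      by (simp add: wedge_Q_e_comp cs.span_base cs.span_zero)
  qed
  then show ?thesis
    using y by (auto simp: cs.span_breakdown_eq)
qed

end

text \<open>
  Any bracketing with the given letters would do. The value for the empty list is arbitrary.
\<close>

definition comb :: "nat set list \<Rightarrow> bracketing" where
  "comb qs = foldr (\<lambda>q t. Bracket (Letter q) t) (butlast qs) (Letter (last qs))"

lemma letters_comb: "qs \<noteq> [] \<Longrightarrow> letters (comb qs) = qs"
proof -
  have "letters (foldr (\<lambda>q t. Bracket (Letter q) t) ps (Letter r)) = ps @ [r]" for ps r
    by (induction ps) auto
  then show "qs \<noteq> [] \<Longrightarrow> letters (comb qs) = qs"
    by (simp add: comb_def)
qed

locale composition_pair = Q: composition A Q + T: composition A T for A Q T +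
  assumes Q_inc: "Q \<in> increasing_set_compositions A" and T_inc: "T \<in> increasing_set_compositions A"
begin

lemma equals_T:
  assumes "U \<in> increasing_set_compositions A" and "length U = length T" and "T \<preceq> U"
  shows "U = T"
  using increasing_set_compositions_unique[OF Q.finite_A assms(1) T_inc]
    refines_length(2)[OF T.Q, of U] assms
  by (auto simp: increasing_set_compositions_def)

text \<open>
  The image of \<open>e\<^sub>T\<close> spans \<open>M\<^sub>T\<close>, so this is the character of \<open>M\<^sub>T\<close>.
\<close>

lemma e_comp_T_eigenvector:
  assumes P: "P \<in> set_compositions A"
  shows "wedge (basis P) (e_comp T) - (if T \<preceq> P then e_comp T else 0)
    \<in> (lie_span (mset T) (length T) :: 'f::field comp_sum set)"
proof (rule T.lie_span_descend)
  let ?e = "e_comp T :: 'f comp_sum"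
  show "wedge (basis P) ?e - (if T \<preceq> P then ?e else 0) \<in> lie_span (mset T) (Suc (length T))"
    using P by (auto intro!: cs.subspace_diff[OF subspace_lie_span] T.wedge_in_lie_span T.e_comp_in_lie_span
        simp: cs.subspace_0[OF subspace_lie_span])
  fix U assume U: "U \<in> increasing_set_compositions A" and len: "length U = length T"
  then have U': "U \<in> set_compositions A" by (simp add: increasing_set_compositions_def)
  have top: "wedge (basis U) (wedge (basis P) ?e) = (if U \<preceq> P then wedge (basis U) ?e else 0)"
    by (rule T.wedge_wedge_top[OF U' P]) (simp add: len T.e_comp_in_lie_span)
  show "wedge (basis U) (wedge (basis P) ?e - (if T \<preceq> P then ?e else 0)) = 0"
  proof (cases "T \<preceq> U")
    case True
    then have "U = T" by (rule equals_T[OF U len])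
    then show ?thesis using top by (simp add: wedge_diff_right)
  next
    case False
    then have "wedge (basis U) ?e = 0"
      by (rule T.wedge_lie_span_cut[OF U' _ T.e_comp_in_lie_span])
    then show ?thesis using top by (simp add: wedge_diff_right)
  qed
qed

lemma simple_module_eq:
  "simple_module A T = quotient_module (ideal_module A (lie_span (mset T) (Suc (length T)))) (lie_span (mset T) (length T))"
  unfolding simple_module_def T.Lambda_eq_ideal_module by (simp add: T.rad_lie_span)

lemma loewy_layer_eq:
  "loewy_layer (comp_algebra A) (Lambda A Q) k =
     quotient_module (ideal_module A (lie_span (mset Q) (Suc (length Q) - k))) (lie_span (mset Q) (length Q - k))"
  unfolding loewy_layer_def Q.rad_power_Lambda by simp

text \<open>
  An isomorphism from \<open>M\<^sub>T\<close> sends the class of \<open>e\<^sub>T\<close> to that of some \<open>v\<close> with the same eigenvalues. Some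
  \<open>U\<close> of the length of the layer does not kill \<open>v\<close>, and computing \<open>U \<and> P \<and> v\<close> in two ways shows that
  \<open>U \<preceq> P\<close> and \<open>T \<preceq> P\<close> are equivalent for all \<open>P\<close>.
\<close>

lemma occurs_only_if:
  assumes "occurs_as_direct_summand (comp_algebra A :: 'f::field comp_sum ring)
    (simple_module A T) (loewy_layer (comp_algebra A) (Lambda A Q) k)"
  shows "Q \<preceq> T \<and> int (length Q) - int (length T) = int k"
proof -
  let ?m = "length Q - k"
  let ?C = "lie_span (mset T) (Suc (length T)) :: 'f comp_sum set"
    and ?N = "lie_span (mset T) (length T) :: 'f comp_sum set"
    and ?C' = "lie_span (mset Q) (Suc (length Q) - k) :: 'f comp_sum set"
    and ?N' = "lie_span (mset Q) ?m :: 'f comp_sum set"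
  let ?M = "quotient_module (ideal_module A ?C) ?N" and ?L = "quotient_module (ideal_module A ?C') ?N'"
  let ?e = "e_comp T :: 'f comp_sum"
  note N = T.left_ideal_lie_span[of "length T", where 'a = 'f]
  note N' = Q.left_ideal_lie_span[of ?m, where 'a = 'f]
  note Ns = subspace_lie_span[of "mset T" "length T", where 'a = 'f]
  note Ns' = subspace_lie_span[of "mset Q" ?m, where 'a = 'f]
  from assms obtain W f where W: "submodule W (comp_algebra A) ?L"
    and f: "f \<in> module_iso (comp_algebra A) ?M (?L\<lparr>carrier := W\<rparr>)"
    unfolding occurs_as_direct_summand_def simple_module_eq loewy_layer_eq by blast
  have WL: "W \<subseteq> coset ?N' ` ?C'"
    using submodule.axioms(1)[OF W] subgroup.subset by (fastforce simp: quotient_carrier)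
  have fW: "f X \<in> W" and f_add: "f (X \<oplus>\<^bsub>?M\<^esub> Y) = f X \<oplus>\<^bsub>?L\<^esub> f Y"
    and f_inj: "f X = f Y \<Longrightarrow> X = Y"
    and f_smult: "Poly_Mapping.keys r \<subseteq> set_compositions A \<Longrightarrow> f (r \<odot>\<^bsub>?M\<^esub> X) = r \<odot>\<^bsub>?L\<^esub> f X"
    if "X \<in> coset ?N ` ?C" "Y \<in> coset ?N ` ?C" for X Y r
    using f that
    by (auto simp: module_iso_def iso_def hom_def quotient_carrier bij_betw_def dest: inj_onD)
  have e: "?e \<in> ?C" by (rule T.e_comp_in_lie_span)
  have zero: "coset ?N 0 \<in> coset ?N ` ?C"
    using cs.subspace_0[OF subspace_lie_span] by blast
  have e': "coset ?N ?e \<in> coset ?N ` ?C" using e by blast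
  obtain u where u: "u \<in> ?C'" "f (coset ?N 0) = coset ?N' u"
    using fW[OF zero zero] WL by blast
  have "coset ?N' (u + u) = coset ?N' u"
    using f_add[OF zero zero] by (simp add: quotient_add[OF Ns] quotient_add[OF Ns'] u)
  then have "u \<in> ?N'"
    by (simp add: coset_eq_iff[OF Ns'])
  then have f0: "f ?N = ?N'"
    using u(2) by (simp add: coset_zero coset_eq_self_iff[OF Ns'])
  obtain v where v: "v \<in> ?C'" "f (coset ?N ?e) = coset ?N' v"
    using fW[OF e' e'] WL by blast
  have "?e \<notin> ?N"
  proof
    assume "?e \<in> ?N"
    then have "wedge (basis T) ?e = 0"
      by (rule T.wedge_lie_span_long[OF T.Q order_refl])
    then show False
      using T.lookup_e_comp[where 'f = 'f] by (simp add: T.wedge_Q_e_comp)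
  qed
  then have "v \<notin> ?N'"
    using f_inj[OF e' zero] v(2) f0 by (auto simp: coset_zero coset_eq_self_iff[OF Ns] coset_eq_self_iff[OF Ns'])
  \<comment> \<open>For \<open>k > \<ell>(Q)\<close> the layer is zero, as both \<open>?C'\<close> and \<open>?N'\<close> are.\<close>
  then have k: "k \<le> length Q"
    using v(1) by (cases "k \<le> length Q") (auto simp: not_le)
  then have C': "?C' = lie_span (mset Q) (Suc ?m)"
    by (simp add: Suc_diff_le)
  have eigen: "wedge (basis P) v - (if T \<preceq> P then v else 0) \<in> ?N'" if P: "P \<in> set_compositions A" for P
  proof -
    have keys: "Poly_Mapping.keys (basis P :: 'f comp_sum) \<subseteq> set_compositions A" using P by simp
    have "coset ?N' (wedge (basis P) v) = f (coset ?N (wedge (basis P) ?e))"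
      using f_smult[OF e' e' keys] by (simp add: quotient_smult[OF N keys] quotient_smult[OF N' keys] v(2))
    also have "coset ?N (wedge (basis P) ?e) = coset ?N (if T \<preceq> P then ?e else 0)"
      using e_comp_T_eigenvector[OF P] by (simp add: coset_eq_iff[OF Ns])
    also have "f \<dots> = coset ?N' (if T \<preceq> P then v else 0)"
      using v(2) f0 by (simp add: coset_zero)
    finally show ?thesis by (simp add: coset_eq_iff[OF Ns'])
  qed
  obtain U where U: "U \<in> increasing_set_compositions A" "length U = ?m" "wedge (basis U) v \<noteq> 0"
    using Q.lie_span_descend[of v ?m] v(1) \<open>v \<notin> ?N'\<close> C' by blast
  then have U': "U \<in> set_compositions A" by (simp add: increasing_set_compositions_def)
  have v': "v \<in> lie_span (mset Q) (Suc (length U))" using v(1) C' U(2) by simp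
  have same: "U \<preceq> P \<longleftrightarrow> T \<preceq> P" if P: "P \<in> set_compositions A" for P
  proof -
    have "wedge (basis U) (wedge (basis P) v - (if T \<preceq> P then v else 0)) = 0"
      by (rule Q.wedge_lie_span_long[OF U' _ eigen[OF P]]) (simp add: U(2))
    then show ?thesis
      using U(3) by (auto simp: wedge_diff_right Q.wedge_wedge_top[OF U' P v'] split: if_splits)
  qed
  have refl: "P \<preceq> P" for P by (auto simp: refines_def)
  have "U \<preceq> T" "T \<preceq> U"
    using same[OF T.Q] same[OF U'] refl by auto
  then have "set U = set T"
    by (rule refines_antisym[OF U' T.Q])
  then have "U = T"
    by (rule increasing_set_compositions_unique[OF Q.finite_A U(1) T_inc])
  moreover have "Q \<preceq> U"
    using Q.wedge_lie_span_cut[OF U' _ v'] U(3) by blast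
  ultimately show ?thesis
    using U(2) k by simp
qed

text \<open>
  The vector \<open>w\<close> is fixed by \<open>T\<close>, and its coefficient at the word \<open>w0\<close> is \<open>1\<close>. Hence \<open>v \<mapsto> (T \<and> v)\<^bsub>w0\<^esub>\<close> is
  a functional whose kernel is a submodule complementary to the line of \<open>w\<close> modulo \<open>D\<^sub>m\<close>. Since
  \<open>T \<and> x\<close> is a multiple of \<open>e\<^sub>T\<close> for \<open>x \<in> \<Lambda>\<^sub>T\<close> and \<open>e\<^sub>T \<and> w = w\<close>, right multiplication by \<open>w\<close> kills
  exactly the radical of \<open>\<Lambda>\<^sub>T\<close> modulo \<open>D\<^sub>m\<close>.
\<close>

lemma occurs_if:
  assumes QT: "Q \<preceq> T" and k: "int (length Q) - int (length T) = int k"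
  shows "occurs_as_direct_summand (comp_algebra A :: 'f::field comp_sum ring)
    (simple_module A T) (loewy_layer (comp_algebra A) (Lambda A Q) k)"
proof -
  let ?m = "length T"
  have len: "length Q - k = ?m" "Suc (length Q) - k = Suc ?m" using k by auto
  let ?C = "lie_span (mset T) (Suc ?m) :: 'f comp_sum set"
    and ?N = "lie_span (mset T) ?m :: 'f comp_sum set"
    and ?C' = "lie_span (mset Q) (Suc ?m) :: 'f comp_sum set"
    and ?N' = "lie_span (mset Q) ?m :: 'f comp_sum set"
  let ?M = "quotient_module (ideal_module A ?C) ?N" and ?L = "quotient_module (ideal_module A ?C') ?N'"
  let ?e = "e_comp T :: 'f comp_sum"
  note D = set_compositionsD[OF Q.Q] set_compositionsD[OF T.Q]
  define inside where "inside p = filter (\<lambda>q. q \<subseteq> p) Q" for p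
  define ts where "ts = map (\<lambda>p. comb (inside p)) T"
  \<comment> \<open>As \<open>Q \<preceq> T\<close>, each block of \<open>T\<close> is a union of blocks of \<open>Q\<close>.\<close>
  have inside: "\<Union>(set (inside p)) = p" if p: "p \<in> set T" for p
  proof
    show "\<Union>(set (inside p)) \<subseteq> p" by (auto simp: inside_def)
    show "p \<subseteq> \<Union>(set (inside p))"
    proof
      fix x assume x: "x \<in> p"
      then obtain q where q: "q \<in> set Q" "x \<in> q" using D(2,6) p by blast
      then obtain p' where p': "p' \<in> set T" "q \<subseteq> p'" using QT by (auto simp: refines_def)
      then have "p' = p" using D(8)[OF p'(1) p] x q by blast
      then show "x \<in> \<Union>(set (inside p))" using q p' by (auto simp: inside_def)
    qed
  qed
  then have letters: "letters (comb (inside p)) = inside p" if "p \<in> set T" for p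
    using D(7)[OF that] inside[OF that] by (intro letters_comb) auto
  have supports: "map support ts = T"
    unfolding ts_def map_map by (rule map_idI) (simp add: support_def letters inside)
  have "map letters ts = map inside T"
    unfolding ts_def map_map by (rule map_cong) (simp_all add: letters)
  then have ts: "mset (concat (map letters ts)) = mset Q"
    using mset_concat_filter_blocks[OF T.Q, of Q "\<lambda>q. q"] QT D(3)
    by (auto simp: inside_def[abs_def] refines_def)
  note ts' = Q.bracketing_in_set_compositions[OF ts]
  define w where "w = (lie_prod ts :: 'f comp_sum)"
  define w0 where "w0 = concat (map letters ts)"
  have "length ts = ?m" by (simp add: ts_def)
  then have wC: "w \<in> ?C'"
    unfolding w_def using ts by (intro lie_prod_in_lie_span) auto
  have Tw: "wedge (basis T) w = w"
    using wedge_supports_lie_prod[OF ts'] by (simp add: supports w_def)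
  have w1: "Poly_Mapping.lookup w w0 = 1"
    using lookup_lie_prod_letters[OF ts' Q.finite_A] by (simp add: w_def w0_def)
  have ew: "wedge ?e w = w"
    using T.e_comp_wedge[of w] Q.wedge_lie_span_long[OF _ _ wC] Tw by simp
  have wedge_w: "wedge x w \<in> ?C'" if "x \<in> ?C" for x
    by (rule left_ideal_wedge[OF Q.left_ideal_lie_span _ wC])
       (use that T.left_ideal_lie_span[of "Suc ?m", where 'a = 'f] in \<open>auto simp: left_ideal_def\<close>)
  have multiple: "\<exists>c. wedge (basis T) x = scl c ?e \<and> wedge (basis T) (wedge x w) = scl c w" if x: "x \<in> ?C" for x
  proof -
    obtain c where c: "wedge (basis T) x = scl c ?e"
      using T.wedge_Q_multiple[OF x] by blast
    have "wedge (basis T) (wedge x w) = wedge (wedge (basis T) x) w"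
      by (simp add: wedge_assoc)
    then show ?thesis
      using c by (auto simp: wedge_scl_left ew)
  qed
  have killed: "x \<in> ?N" if x: "x \<in> ?C" and zero: "wedge (basis T) (wedge x w) = 0" for x
  proof (rule T.lie_span_descend[OF x])
    obtain c where c: "wedge (basis T) x = scl c ?e" "scl c w = 0"
      using multiple[OF x] zero by auto
    have "c * Poly_Mapping.lookup w w0 = 0"
      using c(2) by (metis lookup_scl lookup_zero)
    then have Tx: "wedge (basis T) x = 0"
      using c(1) w1 by simp
    fix U assume U: "U \<in> increasing_set_compositions A" "length U = ?m"
    show "wedge (basis U) x = 0"
    proof (cases "T \<preceq> U")
      case True
      then show ?thesis using equals_T[OF U] Tx by simp
    next
      case False
      then show ?thesis
        using U by (intro T.wedge_lie_span_cut[OF _ _ x]) (auto simp: increasing_set_compositions_def)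
    qed
  qed
  have kernel: "wedge x w \<in> ?N' \<longleftrightarrow> x \<in> ?N" if x: "x \<in> ?C" for x
  proof
    assume "wedge x w \<in> ?N'"
    then have "wedge (basis T) (wedge x w) = 0"
      by (rule Q.wedge_lie_span_long[OF T.Q order_refl])
    then show "x \<in> ?N" by (rule killed[OF x])
  next
    assume xN: "x \<in> ?N"
    show "wedge x w \<in> ?N'"
    proof (rule Q.lie_span_descend[OF wedge_w[OF x]])
      fix U assume "U \<in> increasing_set_compositions A" "length U = ?m"
      then have "wedge (basis U) x = 0"
        using T.wedge_lie_span_long[OF _ _ xN] by (auto simp: increasing_set_compositions_def)
      then show "wedge (basis U) (wedge x w) = 0"
        by (metis wedge_assoc wedge_zero_left)
    qed
  qed
  let ?Y = "(\<lambda>x. wedge x w) ` ?C"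
  let ?V = "{v \<in> ?C'. Poly_Mapping.lookup (wedge (basis T) v) w0 = 0}"
  note C = T.left_ideal_lie_span[of "Suc ?m", where 'a = 'f]
  note N = T.left_ideal_lie_span[of ?m, where 'a = 'f]
  note N' = Q.left_ideal_lie_span[of ?m, where 'a = 'f]
  note Ns' = subspace_lie_span[of "mset Q" ?m, where 'a = 'f]
  have Y: "left_ideal A ?Y"
    by (rule left_ideal_image[OF C]) (use wC Q.left_ideal_lie_span[of "Suc ?m", where 'a = 'f] in \<open>auto simp: left_ideal_def\<close>)
  have V: "left_ideal A ?V"
    using Q.left_ideal_coefficient_kernel[OF T.Q] .
  have sY: "submodule (coset ?N' ` ?Y) (comp_algebra A) ?L"
    by (rule submodule_quotient[OF N' Y]) (use wedge_w in blast)
  have sV: "submodule (coset ?N' ` ?V) (comp_algebra A) ?L"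
    by (rule submodule_quotient[OF N' V]) blast
  have sum: "coset ?N' ` ?Y <+>\<^bsub>?L\<^esub> coset ?N' ` ?V = carrier ?L"
  proof -
    have "coset ?N' ` ?Y <+>\<^bsub>?L\<^esub> coset ?N' ` ?V = {coset ?N' (y + v) | y v. y \<in> ?Y \<and> v \<in> ?V}"
      by (auto simp: set_add_def set_mult_def quotient_add[OF Ns'])
    also have "\<dots> = coset ?N' ` ?C'"
    proof
      show "{coset ?N' (y + v) | y v. y \<in> ?Y \<and> v \<in> ?V} \<subseteq> coset ?N' ` ?C'"
        using wedge_w cs.subspace_add[OF subspace_lie_span] by blast
      show "coset ?N' ` ?C' \<subseteq> {coset ?N' (y + v) | y v. y \<in> ?Y \<and> v \<in> ?V}"
      proof clarify
        fix x assume x: "x \<in> ?C'"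
        let ?c = "Poly_Mapping.lookup (wedge (basis T) x) w0"
        have "wedge (scl ?c ?e) w = scl ?c w" by (simp add: wedge_scl_left ew)
        then have "scl ?c w \<in> ?Y"
          using cs.subspace_scale[OF subspace_lie_span T.e_comp_in_lie_span] by (metis image_eqI)
        moreover have "x - scl ?c w \<in> ?V"
          using x wC by (auto simp: wedge_diff_right wedge_scl_right lookup_minus Tw w1
              intro!: cs.subspace_diff[OF subspace_lie_span] cs.subspace_scale[OF subspace_lie_span])
        moreover have "coset ?N' x = coset ?N' (scl ?c w + (x - scl ?c w))" by simp
        ultimately show "\<exists>y v. coset ?N' x = coset ?N' (y + v) \<and> y \<in> ?Y \<and> v \<in> ?V" by blast
      qed
    qed
    finally show ?thesis by (simp add: quotient_carrier)
  qed
  have int: "coset ?N' ` ?Y \<inter> coset ?N' ` ?V = {\<zero>\<^bsub>?L\<^esub>}"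
  proof
    show "{\<zero>\<^bsub>?L\<^esub>} \<subseteq> coset ?N' ` ?Y \<inter> coset ?N' ` ?V"
      using Y V coset_zero[of ?N'] unfolding left_ideal_def quotient_zero
      by (metis (no_types, lifting) Int_iff cs.subspace_0 image_eqI empty_subsetI insert_subset)
    show "coset ?N' ` ?Y \<inter> coset ?N' ` ?V \<subseteq> {\<zero>\<^bsub>?L\<^esub>}"
    proof
      fix X assume "X \<in> coset ?N' ` ?Y \<inter> coset ?N' ` ?V"
      then obtain x v where x: "x \<in> ?C" "X = coset ?N' (wedge x w)" and v: "v \<in> ?V" "X = coset ?N' v"
        by blast
      from x(2)[symmetric] v(2) have "wedge x w - v \<in> ?N'"
        by (simp flip: coset_eq_iff[OF Ns'])
      then have "wedge (basis T) (wedge x w - v) = 0"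
        by (rule Q.wedge_lie_span_long[OF T.Q order_refl])
      then have "Poly_Mapping.lookup (wedge (basis T) (wedge x w)) w0 = 0"
        using v(1) by (simp add: wedge_diff_right)
      moreover obtain c where c: "wedge (basis T) x = scl c ?e" "wedge (basis T) (wedge x w) = scl c w"
        using multiple[OF x(1)] by blast
      ultimately have "wedge (basis T) (wedge x w) = 0"
        using w1 by simp
      then have "wedge x w \<in> ?N'"
        using kernel[OF x(1)] killed[OF x(1)] by blast
      then show "X \<in> {\<zero>\<^bsub>?L\<^esub>}"
        by (simp add: x(2) quotient_zero coset_eq_self_iff[OF Ns'])
    qed
  qed
  have "module_iso (comp_algebra A) ?M (?L\<lparr>carrier := coset ?N' ` ?Y\<rparr>) \<noteq> {}"
    using right_multiplication_quotient_iso[OF C N N' kernel lie_span_mono[OF le_SucI[OF order_refl]]]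
    by (metis empty_iff)
  then show ?thesis
    unfolding occurs_as_direct_summand_def simple_module_eq loewy_layer_eq len
    using sY sV sum int by blast
qed

end

theorem corollary7p3:
  fixes A :: "nat set" and Q T :: "nat set list" and k :: nat
  assumes "finite A" and "A \<subseteq> {1..}"
    and "Q \<in> increasing_set_compositions A" and "T \<in> increasing_set_compositions A"
  shows "occurs_as_direct_summand (comp_algebra A :: 'f::field comp_sum ring)
           (simple_module A T) (loewy_layer (comp_algebra A) (Lambda A Q) k)
         \<longleftrightarrow> Q \<preceq> T \<and> int (length Q) - int (length T) = int k"
proof -
  interpret composition_pair A Q T
    by unfold_locales (use assms in \<open>simp_all add: increasing_set_compositions_def\<close>)
  show ?thesis
    using occurs_only_if occurs_if by blast
qed

end
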